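(* Let $\alpha_i\in[0,\infty]$, $i\ge1$, and let $p_i=n^{-\alpha_i}$, $i\ge 1$. Let $k\ge1$ satisfy $$\sum_{i=1}^k\binom{k}{i}\alpha_i<1\quad\text{and}\quad q:=\min\{i\ge1:\alpha_i>0\}\le k.$$ In the case $q<k$, suppose also that for every $k_0=q+1,\dots,k$, $$\frac{k-q}{k+1}\binom{k+1}{q+1}\alpha_q+\sum_{j=q+1}^{k_0}\binom{k+1}{j+1}\alpha_j<k_0-q.$$ Let $\sigma_k$ be a $k$-simplex (regarded as the simplicial complex of all its faces). Then there is a constant $C_k\ge1$ (not depending on $n$) such that for all large enough $n$, $$C_k^{-1}n^{q+1-\binom{k}{q}\alpha_q}\le M^*_{\sigma_k,n}\bigl(n^{-\alpha_1},\dots,n^{-\alpha_k}\bigr)\le C_k\,n^{q+1-\binom{k}{q}\alpha_q}.$$ In particular, for every $\varepsilon>0$ there are positive constants $C_k'(\varepsilon),C_k''(\varepsilon)$ (not depending on $n$) such that for all large enough $n$, $$\exp\Bigl\{-C_k'(\varepsilon)n^{q+1-\binom{k}{q}\alpha_q}\log n\Bigr\}\le\mathbb{P}\bigl(N_{o,n}(\sigma_k)\ge(1+\varepsilon)\mu_{o,n}(\sigma_k)\bigr)\le\exp\Bigl\{-C_k''(\varepsilon)n^{q+1-\binom{k}{q}\alpha_q}\Bigr\},$$ where $N_{o,n}(\sigma_k)$ is the number of ordered copies of $\sigma_k$ in the multi-parameter random simplicial complex $K(n;p_1,\dots,p_{n-1})$ and $\mu_{o,n}(\sigma_k)=\mathb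b{E}[N_{o,n}(\sigma_k)]$.
   Context: Simplicial complexes are finite abstract simplicial complexes. For a complex $F$, $s_i(F)$ is the number of $i$-simplices of $F$. For $\sigma_k$ one has $s_i(\sigma_k)=\binom{k+1}{i+1}$, $0\le i\le k$. Convention: $n^{-\infty}=0$. Random complex: $K(n;p_1,\dots,p_{n-1})$ is built on the vertex set $[n]=\{1,\dots,n\}$ recursively: all $n$ vertices are present; for $i=1,\dots,n-1$, once the $(i-1)$-skeleton has been constructed, each potential $i$-simplex (set of $i+1$ vertices) whose whole boundary lies in that $(i-1)$-skeleton is added with probability $p_i$, independently of the other potential $i$-simplices. Copies: an ordered copy of $F_1$ in $F_2$ is an injective map from the vertex set of $F_1$ to the vertex set of $F_2$ which maps the vertex set of every simplex of $F_1$ onto the vertex set of a simplex of $F_2$ (of the same dimension). An unordered copy of $F_1$ in $F_2$ is a subcomplex of $F_2$ isomorphic to $F_1$; $n(F_2,F_1)$ is the number of unordered copies. For a $k$-simplex, $N_{o,n}(\sigma_k)$ equals $(k+1)!$ times the number of $k$-simplices in the random complex, and $\mu_{o,n}(\sigma_k)=n(n-1)\cdots(n-k)\prod_{i=1}^kp_i^{\binom{k+1}{i+1}}$. Extremal parameter: for a complex $H$ of dimension at most $k$ and numbers $m_0,\dots,m_k$, $N(m_0,m_1,\dots,m_k;H)$ is the maximum of $n(F,H)$ over all simplicial complexes $F$ with $s_i(F)\le m_i$ for $i=0,1,\dots,k$. For a complex $H$ of dimension at most $k$ put $\Psi_{H,n}=n^{s_0(H)}\prod_{i=1}^kp_i^{s_i(H)}$.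 For a complex $G$ of dimension $k$, $$M^*_{G,n}(p_1,\dots,p_k)=\max\Bigl\{m \text{ integer},\ 1\le m\le\tbinom{n}{k+1}/s_k(G):\ N\bigl(n,ms_1(G),\dots,ms_k(G);H\bigr)\le\Psi_{H,n}\ \text{for every non-empty subcomplex }H\text{ of }G\Bigr\}.$$ *)

theory Defs
  imports "HOL-Probability.Probability"
begin

text \<open>
  A finite abstract simplicial complex is represented by the set of its non-empty simplices, each
  simplex being the set of its vertices; the vertex set of \<open>K\<close> is \<open>\<Union>K\<close>, and an
  \<open>i\<close>-simplex is a member of cardinality \<open>i + 1\<close>. The empty complex is \<open>{}\<close>.
\<close>

definition abstract_complex :: "'a set set \<Rightarrow> bool" where
  "abstract_complex K \<longleftrightarrow>
     finite K \<and> (\<forall>s\<in>K. finite s \<and> s \<noteq> {}) \<and>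
     (\<forall>s\<in>K. \<forall>t. t \<subseteq> s \<and> t \<noteq> {} \<longrightarrow> t \<in> K)"

definition subcomplex :: "'a set set \<Rightarrow> 'a set set \<Rightarrow> bool" where
  "subcomplex H K \<longleftrightarrow> abstract_complex H \<and> H \<subseteq> K"

definition num_simplices :: "nat \<Rightarrow> 'a set set \<Rightarrow> nat" where
  "num_simplices i K = card {s \<in> K. card s = i + 1}"

definition std_simplex :: "nat \<Rightarrow> nat set set" where
  "std_simplex k = {s. s \<subseteq> {0..k} \<and> s \<noteq> {}}"

definition complex_iso :: "'a set set \<Rightarrow> 'b set set \<Rightarrow> bool" where
  "complex_iso H K \<longleftrightarrow> (\<exists>f. bij_betw f (\<Union>H) (\<Union>K) \<and> (\<lambda>s. f ` s) ` H = K)"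

definition unordered_copies :: "'a set set \<Rightarrow> 'b set set \<Rightarrow> nat" where
  "unordered_copies F H = card {F'. subcomplex F' F \<and> complex_iso H F'}"

text \<open>
  Ordered copies of \<open>H\<close> in \<open>F\<close>. Extensionality of the maps makes each map on the
  vertex set count exactly once; an injective map preserves the dimension of simplices.
\<close>

definition ordered_copies :: "'a set set \<Rightarrow> 'b set set \<Rightarrow> nat" where
  "ordered_copies F H =
     card {f \<in> \<Union>H \<rightarrow>\<^sub>E \<Union>F. inj_on f (\<Union>H) \<and> (\<forall>s\<in>H. f ` s \<in> F)}"

text \<open>
  The extremal parameter \<open>N(m\<^sub>0,\<dots>,m\<^sub>k;H)\<close>. As \<open>n(F,H)\<close> only depends on the isomorphism
  type of the finite complex \<open>F\<close>, it is enough to let \<open>F\<close> have natural numbers as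
  vertices. The values form a finite non-empty set, because \<open>F\<close> has at most \<open>m\<^sub>0\<close>
  vertices.
\<close>

definition extremal_copies :: "nat \<Rightarrow> (nat \<Rightarrow> nat) \<Rightarrow> 'b set set \<Rightarrow> nat" where
  "extremal_copies k m H =
     Max {unordered_copies F H | F :: nat set set.
            abstract_complex F \<and> (\<forall>i\<le>k. num_simplices i F \<le> m i)}"

definition Psi :: "nat \<Rightarrow> (nat \<Rightarrow> real) \<Rightarrow> nat \<Rightarrow> 'a set set \<Rightarrow> real" where
  "Psi k p n H = real n ^ num_simplices 0 H * (\<Prod>i=1..k. p i ^ num_simplices i H)"

text \<open>
  \<open>M_star k p n G\<close> is meant for \<open>G\<close> of dimension \<open>k\<close>. If no \<open>m\<close> is admissible,
  its value is that of the unspecified term \<open>Max {}\<close>.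
\<close>

definition M_star :: "nat \<Rightarrow> (nat \<Rightarrow> real) \<Rightarrow> nat \<Rightarrow> 'a set set \<Rightarrow> nat" where
  "M_star k p n G =
     Max {m. 1 \<le> m \<and> real m \<le> real (n choose (k + 1)) / real (num_simplices k G) \<and>
             (\<forall>H. subcomplex H G \<and> H \<noteq> {} \<longrightarrow>
                real (extremal_copies k (\<lambda>i. if i = 0 then n else m * num_simplices i G) H)
                  \<le> Psi k p n H)}"

text \<open>The \<open>i\<close>-simplices on \<open>[n]\<close> whose whole boundary lies in the complex \<open>L\<close>.\<close>

definition potential_simplices :: "nat \<Rightarrow> nat \<Rightarrow> nat set set \<Rightarrow> nat set set" where
  "potential_simplices n i L =
     {s. s \<subseteq> {1..n} \<and> card s = i + 1 \<and> (\<forall>t. t \<subset> s \<and> t \<noteq> {} \<longrightarrow> t \<in> L)}"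

definition random_subset :: "'a set \<Rightarrow> real \<Rightarrow> 'a set pmf" where
  "random_subset A r =
     map_pmf (\<lambda>f. {x \<in> A. f x}) (Pi_pmf A False (\<lambda>_. bernoulli_pmf r))"

fun random_skeleton :: "nat \<Rightarrow> (nat \<Rightarrow> real) \<Rightarrow> nat \<Rightarrow> nat set set pmf" where
  "random_skeleton n p 0 = return_pmf ((\<lambda>v. {v}) ` {1..n})"
| "random_skeleton n p (Suc i) =
     bind_pmf (random_skeleton n p i)
       (\<lambda>L. map_pmf (\<lambda>S. L \<union> S) (random_subset (potential_simplices n (Suc i) L) (p (Suc i))))"

definition random_complex :: "nat \<Rightarrow> (nat \<Rightarrow> real) \<Rightarrow> nat set set pmf" where
  "random_complex n p = random_skeleton n p (n - 1)"

definition expected_ordered_copies :: "nat \<Rightarrow> (nat \<Rightarrow> real) \<Rightarrow> 'a set set \<Rightarrow> real" where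
  "expected_ordered_copies n p H =
     measure_pmf.expectation (random_complex n p) (\<lambda>K. real (ordered_copies K H))"

text \<open>\<open>p\<^sub>i = n\<^bsup>-\<alpha>\<^sub>i\<^esup>\<close> for \<open>\<alpha>\<^sub>i \<in> [0,\<infinity>]\<close>, with the convention \<open>n\<^bsup>-\<infinity>\<^esup> = 0\<close>.\<close>

definition power_prob :: "(nat \<Rightarrow> ennreal) \<Rightarrow> nat \<Rightarrow> nat \<Rightarrow> real" where
  "power_prob \<alpha> n i = (if \<alpha> i = \<infinity> then 0 else real n powr (- enn2real (\<alpha> i)))"

end

theory Submission
  imports Defs
begin

text \<open>
  Write \<open>B = (k choose q) \<alpha>\<^sub>q\<close> and \<open>e = q + 1 - B\<close>. Upper bounds rest on one count: in a
  family with at most \<open>c n^e\<close> sets of each size \<open>q + 1, \<dots>, k + 1\<close>, the images of a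
  subcomplex \<open>H\<close> of \<open>\<sigma>\<^sub>k\<close> number at most a small multiple of \<open>\<Psi>\<^sub>H\<close>. If \<open>H\<close> has a simplex of
  dimension \<open>k\<^sub>0 > q\<close>, counting the images of a single top-dimensional simplex suffices, which is
  exactly what the hypothesis on \<open>k\<^sub>0\<close> says; if \<open>H\<close> has dimension \<open>q\<close>, every vertex lies in at most
  \<open>k choose q\<close> of its \<open>q\<close>-simplices and Finner's inequality applies. The count bounds \<open>M\<^sup>*\<close> from
  below and, through the moments of order \<open>l\<close> proportional to \<open>n^e\<close> and Markov's inequality, the
  upper tail from above.

  For the opposite bounds one makes about \<open>n powr (1 - B)\<close> vertices into centres and takes all
  \<open>q\<close>-simplices through a centre, in addition to the full \<open>(q - 1)\<close>-skeleton (whose simplices have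
  probability 1). This complex has too many copies of the star of a vertex in the \<open>q\<close>-skeleton of
  \<open>\<sigma>\<^sub>k\<close>; if the random complex contains it, which costs \<open>exp (- O (n^e log n))\<close>, the expected
  number of \<open>k\<close>-simplices is multiplied by a large constant.
\<close>

section \<open>Finner's inequality\<close>

text \<open>The exponent \<open>e\<close> is dictated by a single vertex of
  \<open>\<sigma>_k\<close>. It lies in \<open>k choose q\<close> simplices of dimension
  \<open>q\<close>, so once all \<open>q\<close>-simplices through \<open>h\<close> centres are
  present, a map sending this vertex to a centre gains the factor \<open>n powr B\<close>, and a
  fraction of about \<open>h / n\<close> of all maps does so. The expected count grows by a constant
  factor when \<open>h\<close> is of order \<open>n powr (1 - B)\<close>, and the planted
  \<open>q\<close>-simplices then number at most \<open>h * n ^ q\<close>, which is of order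
  \<open>n powr e\<close>. The opposite bounds need that no family with \<open>c * n powr e\<close>
  sets of each size does better. A new copy can meet the union of earlier copies in many different
  families of faces, so the count is stated for an arbitrary family \<open>H\<close>. Its bound
  carries the factor \<open>c powr (1 / (k choose q))\<close>, which is small for small
  \<open>c\<close>: this lets each further copy in a moment contribute at most
  \<open>1 + \<epsilon> / 2\<close> times the expectation. For \<open>M_star\<close> the value
  \<open>c = 1\<close> is enough.\<close>

lemma prod_powr_le_affine:
  fixes b :: "'j \<Rightarrow> real"
  assumes "finite J" "card J \<le> D" "D > 0" and b: "\<And>j. j \<in> J \<Longrightarrow> b j \<ge> 0"
  shows "(\<Prod>j\<in>J. b j powr (1 / D)) \<le> 1 + (\<Sum>j\<in>J. b j - 1) / D"
proof (cases "\<exists>j\<in>J. b j = 0")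
  case True
  then have "(\<Prod>j\<in>J. b j powr (1 / D)) = 0"
    using assms(1) by (auto intro!: prod_zero)
  moreover have "0 \<le> 1 + (\<Sum>j\<in>J. b j - 1) / D"
  proof -
    have "- real (card J) \<le> (\<Sum>j\<in>J. b j - 1)"
      using sum_nonneg[of J b] b by (simp add: sum_subtractf)
    then have "- real D \<le> (\<Sum>j\<in>J. b j - 1)" using assms(2) by linarith
    then show ?thesis using assms(3) by (simp add: field_simps)
  qed
  ultimately show ?thesis by simp
next
  case False
  then have pos: "\<And>j. j \<in> J \<Longrightarrow> b j > 0" using b by fastforce
  \<comment> \<open>The dummy point \<open>None\<close>, of weight \<open>1 - card J / D\<close> and
    value \<open>exp 0 = 1\<close>, makes the weights sum to 1 even if \<open>card J < D\<close>;
    the claim is then Jensen's inequality for \<open>exp\<close>. The affine form is chosen because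
    the deviations \<open>b j - 1\<close> cancel when every \<open>b j\<close> is normalised to have
    mean 1.\<close>
  let ?S = "insert None (Some ` J)"
  let ?a = "\<lambda>x. case x of None \<Rightarrow> 1 - card J / D | Some j \<Rightarrow> 1 / real D"
  let ?y = "\<lambda>x. case x of None \<Rightarrow> 0 | Some j \<Rightarrow> ln (b j)"
  have sum: "(\<Sum>x\<in>?S. f x) = f None + (\<Sum>j\<in>J. f (Some j))" for f :: "'j option \<Rightarrow> real"
    using assms(1) by (subst sum.insert) (auto simp: sum.reindex)
  have "exp (\<Sum>x\<in>?S. ?a x *\<^sub>R ?y x) \<le> (\<Sum>x\<in>?S. ?a x * exp (?y x))"
    using assms by (intro convex_on_sum[OF _ _ exp_convex]) (auto simp: sum split: option.splits)
  then have "exp (\<Sum>j\<in>J. ln (b j) / D) \<le> 1 - card J / D + (\<Sum>j\<in>J. b j / D)"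
    using pos by (simp add: sum)
  moreover have "exp (\<Sum>j\<in>J. ln (b j) / D) = (\<Prod>j\<in>J. b j powr (1 / D))"
    unfolding exp_sum[OF assms(1)] using pos
    by (intro prod.cong) (auto simp: powr_def mult.commute dest: pos)
  ultimately show ?thesis by (simp add: sum_subtractf diff_divide_distrib sum_divide_distrib)
qed

text \<open>Dividing each \<open>a j\<close> by its mean \<open>c j\<close> makes the correction
  terms of the affine bound cancel in the sum over \<open>v\<close>. This is Hoelder's inequality
  with all exponents equal to \<open>D\<close>; fewer than \<open>D\<close> factors are allowed
  because averages are taken instead of sums.\<close>

lemma Holder_average:
  fixes a :: "'j \<Rightarrow> 'v \<Rightarrow> real"
  assumes "finite J" "card J \<le> D" "D > 0" "finite V"
    and nn: "\<And>j v. j \<in> J \<Longrightarrow> v \<in> V \<Longrightarrow> a j v \<ge> 0"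
  shows "(\<Sum>v\<in>V. \<Prod>j\<in>J. a j v powr (1 / D)) / card V
           \<le> (\<Prod>j\<in>J. ((\<Sum>v\<in>V. a j v) / card V) powr (1 / D))"
proof (cases "\<exists>j\<in>J. (\<Sum>v\<in>V. a j v) = 0 \<or> V = {}")
  case True
  then obtain j where j: "j \<in> J" "(\<Sum>v\<in>V. a j v) = 0 \<or> V = {}" by blast
  then have "\<And>v. v \<in> V \<Longrightarrow> a j v = 0"
    using nn assms(4) by (auto simp: sum_nonneg_eq_0_iff)
  then have "(\<Sum>v\<in>V. \<Prod>j\<in>J. a j v powr (1 / D)) = 0"
    using j assms(1) by (intro sum.neutral ballI prod_zero) auto
  then show ?thesis by (simp add: prod_nonneg)
next
  case False
  show ?thesis
  proof (cases "V = {}")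
    case True
    then show ?thesis by (simp add: prod_nonneg)
  next
    case V: False
    define c where "c j = (\<Sum>v\<in>V. a j v) / card V" for j
    have cV: "card V > 0" using V assms(4) by (simp add: card_gt_0_iff)
    have c: "c j > 0" if "j \<in> J" for j
      using False that cV nn[OF that] unfolding c_def
      by (metis divide_pos_pos of_nat_0_less_iff order_le_less sum_nonneg)
    have "(\<Sum>v\<in>V. \<Prod>j\<in>J. a j v powr (1 / D))
        = (\<Sum>v\<in>V. (\<Prod>j\<in>J. c j powr (1 / D)) * (\<Prod>j\<in>J. (a j v / c j) powr (1 / D)))"
      unfolding prod.distrib[symmetric] using c nn
      by (intro sum.cong prod.cong refl) (simp add: powr_divide less_imp_le less_imp_neq[symmetric])
    also have "\<dots> \<le> (\<Sum>v\<in>V. (\<Prod>j\<in>J. c j powr (1 / D)) * (1 + (\<Sum>j\<in>J. a j v / c j - 1) / D))"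
      using assms c by (intro sum_mono mult_left_mono prod_powr_le_affine prod_nonneg)
        (auto simp: less_imp_le)
    also have "\<dots> = (\<Prod>j\<in>J. c j powr (1 / D)) * (card V + (\<Sum>v\<in>V. \<Sum>j\<in>J. a j v / c j - 1) / D)"
      by (simp add: sum_distrib_left[symmetric] sum.distrib sum_divide_distrib)
    also have "(\<Sum>v\<in>V. \<Sum>j\<in>J. a j v / c j - 1) = (\<Sum>j\<in>J. (\<Sum>v\<in>V. a j v) / c j - card V)"
      by (subst sum.swap) (simp add: sum_subtractf sum_divide_distrib)
    also have "\<dots> = 0"
    proof (intro sum.neutral ballI)
      fix j assume "j \<in> J"
      then show "(\<Sum>v\<in>V. a j v) / c j - card V = 0"
        using c[of j] cV by (auto simp: c_def field_simps)
    qed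
    finally show ?thesis using cV by (simp add: c_def field_simps)
  qed
qed

lemma sum_PiE_insert:
  assumes "finite I" "i \<notin> I" "finite V"
  shows "(\<Sum>f\<in>insert i I \<rightarrow>\<^sub>E V. h f) = (\<Sum>f\<in>I \<rightarrow>\<^sub>E V. \<Sum>v\<in>V. h (f(i := v)))"
proof -
  have "(\<Sum>f\<in>insert i I \<rightarrow>\<^sub>E V. h f) = (\<Sum>(v, f)\<in>V \<times> (I \<rightarrow>\<^sub>E V). h (f(i := v)))"
    unfolding PiE_insert_eq
    by (subst sum.reindex[OF inj_combinator[OF assms(2)]]) (simp add: case_prod_unfold)
  also have "\<dots> = (\<Sum>f\<in>I \<rightarrow>\<^sub>E V. \<Sum>v\<in>V. h (f(i := v)))"
    by (subst sum.cartesian_product[symmetric], subst sum.swap) simp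
  finally show ?thesis .
qed

text \<open>Induction on the set of coordinates. Averaging over the coordinate \<open>i\<close> only
  concerns the factors with \<open>i \<in> S j\<close>; there are at most \<open>D\<close> of them,
  so Hoelder's inequality applies. The other factors are constant in this coordinate and, thanks to
  the normalisation, equal to their averages. Each average \<open>h j\<close> again depends only on
  the coordinates in \<open>S j\<close>.\<close>

lemma Finner_average:
  fixes g :: "'j \<Rightarrow> ('i \<Rightarrow> 'v) \<Rightarrow> real"
  assumes "finite I" "finite J" "D > 0" "finite V"
    and "\<And>i. i \<in> I \<Longrightarrow> card {j \<in> J. i \<in> S j} \<le> D"
    and "\<And>j f. j \<in> J \<Longrightarrow> g j f \<ge> 0"
    and "\<And>j f f'. j \<in> J \<Longrightarrow> (\<And>i. i \<in> S j \<Longrightarrow> f i = f' i) \<Longrightarrow> g j f = g j f'"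
  shows "(\<Sum>f\<in>I \<rightarrow>\<^sub>E V. \<Prod>j\<in>J. g j f powr (1 / D)) / real (card V) ^ card I
           \<le> (\<Prod>j\<in>J. ((\<Sum>f\<in>I \<rightarrow>\<^sub>E V. g j f) / real (card V) ^ card I) powr (1 / D))"
  using assms(1) assms(5-)
proof (induction I arbitrary: g rule: finite_induct)
  case empty
  show ?case by simp
next
  case (insert i I)
  show ?case
  proof (cases "V = {}")
    case True
    then show ?thesis using insert.hyps by (simp add: prod_nonneg PiE_eq_empty_iff)
  next
    case False
    then have cV: "card V > 0" using assms(4) by (simp add: card_gt_0_iff)
    define h where "h j f = (\<Sum>v\<in>V. g j (f(i := v))) / card V" for j f
    have step: "(\<Sum>v\<in>V. \<Prod>j\<in>J. g j (f(i := v)) powr (1 / D)) / card V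
        \<le> (\<Prod>j\<in>J. h j f powr (1 / D))" for f
    proof -
      let ?A = "{j \<in> J. i \<in> S j}" and ?B = "{j \<in> J. i \<notin> S j}"
      have J: "J = ?A \<union> ?B" by blast
      have split: "(\<Prod>j\<in>J. u j) = (\<Prod>j\<in>?A. u j) * (\<Prod>j\<in>?B. u j)" for u :: "'j \<Rightarrow> real"
        using assms(2) by (subst J, subst prod.union_disjoint) auto
      have same: "g j (f(i := v)) = g j f" if "j \<in> ?B" for j v
      proof (rule insert.prems(3))
        show "j \<in> J" using that by simp
        show "(f(i := v)) x = f x" if "x \<in> S j" for x
          using that \<open>j \<in> ?B\<close> by auto
      qed
      have B: "(\<Prod>j\<in>?B. g j (f(i := v)) powr (1 / D)) = (\<Prod>j\<in>?B. h j f powr (1 / D))" for v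
        using same cV by (intro prod.cong) (auto simp: h_def)
      have "(\<Sum>v\<in>V. \<Prod>j\<in>J. g j (f(i := v)) powr (1 / D)) / card V
          = (\<Sum>v\<in>V. \<Prod>j\<in>?A. g j (f(i := v)) powr (1 / D)) / card V * (\<Prod>j\<in>?B. h j f powr (1 / D))"
        unfolding split B by (simp add: sum_distrib_right)
      also have "\<dots> \<le> (\<Prod>j\<in>?A. h j f powr (1 / D)) * (\<Prod>j\<in>?B. h j f powr (1 / D))"
        unfolding h_def using assms(2-4) insert.prems(1,2)
        by (intro mult_right_mono Holder_average prod_nonneg) auto
      finally show ?thesis unfolding split .
    qed
    have sums: "(\<Sum>f\<in>insert i I \<rightarrow>\<^sub>E V. u f) / real (card V) ^ card (insert i I)
        = (\<Sum>f\<in>I \<rightarrow>\<^sub>E V. (\<Sum>v\<in>V. u (f(i := v))) / card V) / real (card V) ^ card I" for u :: "_ \<Rightarrow> real"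
      using insert.hyps assms(4)
      by (simp add: sum_PiE_insert sum_divide_distrib[symmetric])
    have "(\<Sum>f\<in>insert i I \<rightarrow>\<^sub>E V. \<Prod>j\<in>J. g j f powr (1 / D)) / real (card V) ^ card (insert i I)
        \<le> (\<Sum>f\<in>I \<rightarrow>\<^sub>E V. \<Prod>j\<in>J. h j f powr (1 / D)) / real (card V) ^ card I"
      unfolding sums by (intro divide_right_mono sum_mono step) auto
    also have "\<dots> \<le> (\<Prod>j\<in>J. ((\<Sum>f\<in>I \<rightarrow>\<^sub>E V. h j f) / real (card V) ^ card I) powr (1 / D))"
    proof (rule insert.IH)
      show "h j f = h j f'" if "j \<in> J" "\<And>i. i \<in> S j \<Longrightarrow> f i = f' i" for j f f'
        unfolding h_def using that by (intro arg_cong2[of _ _ _ _ "(/)"] sum.cong insert.prems(3)) auto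
      show "h j f \<ge> 0" if "j \<in> J" for j f
        unfolding h_def using insert.prems(2)[OF that] by (simp add: sum_nonneg)
    qed (use insert.prems(1) in auto)
    also have "\<dots> = (\<Prod>j\<in>J. ((\<Sum>f\<in>insert i I \<rightarrow>\<^sub>E V. g j f) / real (card V) ^ card (insert i I)) powr (1 / D))"
      unfolding sums h_def ..
    finally show ?thesis .
  qed
qed

text \<open>Such a map is determined by the image of \<open>s\<close>, by its restriction to
  \<open>s\<close>, which is an injection into that image, and by its values on
  \<open>I - s\<close>. The factorial counts the injections. The inequality is multiplied out by
  \<open>card V ^ card s\<close>.\<close>

lemma card_maps_onto_simplex:
  assumes "finite I" "finite V" "finite F" "s \<subseteq> I"
  shows "real (card {f \<in> I \<rightarrow>\<^sub>E V. f ` s \<in> F \<and> card (f ` s) = card s}) * real (card V) ^ card s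
    \<le> fact (card s) * real (card {t \<in> F. card t = card s}) * real (card V) ^ card I"
proof -
  let ?X = "{f \<in> I \<rightarrow>\<^sub>E V. f ` s \<in> F \<and> card (f ` s) = card s}"
  let ?E = "{t \<in> F. card t = card s \<and> finite t}"
  let ?Y = "(SIGMA t : ?E. {g \<in> s \<rightarrow>\<^sub>E t. inj_on g s}) \<times> ((I - s) \<rightarrow>\<^sub>E V)"
  have fin: "finite s" by (rule finite_subset[OF assms(4,1)])
  let ?h = "\<lambda>f. ((f ` s, restrict f s), restrict f (I - s))"
  have Y: "finite ?Y"
    using fin assms(1-3)
    by (intro finite_cartesian_product finite_SigmaI finite_subset[OF Collect_restrict] finite_PiE) auto
  have "inj_on ?h ?X"
  proof (rule inj_onI)
    fix f g assume fg: "f \<in> ?X" "g \<in> ?X" "?h f = ?h g"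
    show "f = g"
    proof
      fix x
      consider "x \<in> s" | "x \<in> I - s" | "x \<notin> I" by blast
      then show "f x = g x"
      proof cases
        case 1
        then show ?thesis using fg(3) by (metis prod.inject restrict_apply')
      next
        case 2
        then show ?thesis using fg(3) by (metis prod.inject restrict_apply')
      next
        case 3
        then show ?thesis using fg(1,2) by (auto simp: PiE_def extensional_def)
      qed
    qed
  qed
  moreover have "?h ` ?X \<subseteq> ?Y"
    using fin assms(4) by (auto simp: inj_on_restrict_eq eq_card_imp_inj_on)
  ultimately have "card ?X \<le> card ?Y" using Y by (rule card_inj_on_le)
  also have "card ?Y = (\<Sum>t\<in>?E. card {g \<in> s \<rightarrow>\<^sub>E t. inj_on g s}) * card V ^ card (I - s)"
    using fin assms by (simp add: card_cartesian_product card_SigmaI card_PiE finite_PiE)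
  also have "(\<Sum>t\<in>?E. card {g \<in> s \<rightarrow>\<^sub>E t. inj_on g s}) = (\<Sum>t\<in>?E. fact (card s))"
    using fin by (intro sum.cong refl, subst card_inj_on_subset_funcset) (auto simp: fact_prod_rev)
  also have "\<dots> = card ?E * fact (card s)" by simp
  also have "card ?E \<le> card {t \<in> F. card t = card s}"
    using assms(3) by (intro card_mono) auto
  finally have "card ?X \<le> card {t \<in> F. card t = card s} * fact (card s) * card V ^ card (I - s)"
    by simp
  then have "real (card ?X) \<le> real (card {t \<in> F. card t = card s} * fact (card s) * card V ^ card (I - s))"
    by linarith
  then have "real (card ?X) * real (card V) ^ card s \<le> real (card {t \<in> F. card t = card s} * fact (card s) * card V ^ card (I - s)) * real (card V) ^ card s"
    by (rule mult_right_mono) simp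
  also have "\<dots> = fact (card s) * real (card {t \<in> F. card t = card s}) * real (card V) ^ (card (I - s) + card s)"
    by (simp add: power_add algebra_simps)
  also have "card (I - s) + card s = card I"
    using assms fin by (simp add: card_Diff_subset card_mono)
  finally show ?thesis .
qed

lemma card_subsets_containing:
  assumes "finite A" "i \<in> A"
  shows "card {s. s \<subseteq> A \<and> i \<in> s \<and> card s = Suc q} = (card A - 1) choose q"
proof -
  have "{s. s \<subseteq> A \<and> i \<in> s \<and> card s = Suc q} = insert i ` {s. s \<subseteq> A - {i} \<and> card s = q}"
  proof (intro set_eqI iffI)
    fix s assume s: "s \<in> {s. s \<subseteq> A \<and> i \<in> s \<and> card s = Suc q}"
    then have "s = insert i (s - {i})" "s - {i} \<subseteq> A - {i}" "card (s - {i}) = q" by auto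
    then show "s \<in> insert i ` {s. s \<subseteq> A - {i} \<and> card s = q}" by blast
  next
    fix s assume "s \<in> insert i ` {s. s \<subseteq> A - {i} \<and> card s = q}"
    then obtain t where t: "s = insert i t" "t \<subseteq> A - {i}" "card t = q" by blast
    then have "i \<notin> t" "finite t" using assms finite_subset[of t A] by auto
    then show "s \<in> {s. s \<subseteq> A \<and> i \<in> s \<and> card s = Suc q}" using t assms by auto
  qed
  moreover have "inj_on (insert i) {s. s \<subseteq> A - {i} \<and> card s = q}"
    by (intro inj_onI) blast
  ultimately show ?thesis using assms by (simp add: card_image n_subsets)
qed

section \<open>Maps of a complex into a sparse family\<close>

text \<open>Vertices are always present, so they carry weight 1.\<close>

definition simplex_weight :: "(nat \<Rightarrow> real) \<Rightarrow> 'a set \<Rightarrow> real" where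
  "simplex_weight p s = (if card s \<le> 1 then 1 else p (card s - 1))"

text \<open>
  The assumption \<open>top\<close> is the hypothesis of the theorem on \<open>k\<^sub>0\<close>, rewritten with the identity
  \<open>(q + 1) ((k + 1) choose (q + 1)) = (k + 1) (k choose q)\<close>.
\<close>

locale clique_exponents =
  fixes k q :: nat and a :: "nat \<Rightarrow> real" and p :: "nat \<Rightarrow> nat \<Rightarrow> real"
  assumes q: "1 \<le> q" "q \<le> k"
    and a_nonneg: "\<And>i. 1 \<le> i \<Longrightarrow> i \<le> k \<Longrightarrow> 0 \<le> a i"
    and a_zero: "\<And>i. 1 \<le> i \<Longrightarrow> i < q \<Longrightarrow> a i = 0"
    and a_q: "0 < a q"
    and degree: "real (k choose q) * a q < 1"
    and top: "\<And>k0. q < k0 \<Longrightarrow> k0 \<le> k \<Longrightarrow>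
      (\<Sum>j=q..k0. real ((k + 1) choose (j + 1)) * a j) \<le> real k0 - real q + real (k choose q) * a q"
    and p_eq: "\<And>n i. 1 \<le> n \<Longrightarrow> 1 \<le> i \<Longrightarrow> i \<le> k \<Longrightarrow> p n i = real n powr (- a i)"
    and p_bounds: "\<And>n i. 1 \<le> n \<Longrightarrow> 0 \<le> p n i \<and> p n i \<le> 1"
begin

abbreviation "B \<equiv> real (k choose q) * a q"

lemma B_pos: "B > 0" using mult_pos_pos[OF _ a_q, of "real (k choose q)"] q(2) by simp

text \<open>A size above \<open>q\<close> means dimension at least \<open>q\<close>. Smaller
  simplices have probability 1, as vertices or because \<open>a\<close> vanishes below
  \<open>q\<close>, so all weights reduce to exponents of sizes above \<open>q\<close>.\<close>

lemma simplex_weight_eq: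
  assumes "n \<ge> 1" "card s \<le> k + 1"
  shows "simplex_weight (p n) s = (if q < card s then real n powr - a (card s - 1) else 1)"
proof (cases "card s \<le> 1")
  case True
  then show ?thesis using q by (simp add: simplex_weight_def)
next
  case False
  then have s: "1 \<le> card s - 1" "card s - 1 \<le> k" using assms(2) by linarith+
  have "simplex_weight (p n) s = real n powr - a (card s - 1)"
    using False p_eq[OF assms(1) s] by (simp add: simplex_weight_def)
  moreover have "a (card s - 1) = 0" if "\<not> q < card s"
    using that s by (intro a_zero) linarith+
  ultimately show ?thesis using assms(1) by simp
qed

lemma prod_weight_eq:
  assumes "n \<ge> 1" "finite H" "\<And>s. s \<in> H \<Longrightarrow> card s \<le> k + 1"
  shows "(\<Prod>s\<in>H. simplex_weight (p n) s)
    = real n powr - (\<Sum>s\<in>{s\<in>H. q < card s}. a (card s - 1))"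
proof -
  have "(\<Prod>s\<in>H. simplex_weight (p n) s)
      = (\<Prod>s\<in>H. if q < card s then real n powr - a (card s - 1) else 1)"
    by (intro prod.cong refl simplex_weight_eq assms)
  also have "\<dots> = (\<Prod>s\<in>{s\<in>H. q < card s}. real n powr - a (card s - 1))"
    by (rule prod.inter_filter[symmetric, OF assms(2)])
  also have "\<dots> = real n powr (\<Sum>s\<in>{s\<in>H. q < card s}. - a (card s - 1))"
    using assms(1) by (subst powr_sum) auto
  finally show ?thesis by (simp add: sum_negf)
qed

text \<open>The family is enlarged to all faces of \<open>\<sigma>_k\<close> of dimension
  \<open>q\<close> to \<open>k0\<close>, which is affordable since the exponents are nonnegative.
  The assumption \<open>top\<close> bounds exactly this full sum.\<close>

lemma sum_exponents_le:
  assumes "H \<subseteq> Pow {0..k}" "\<And>s. s \<in> H \<Longrightarrow> card s \<le> k0 + 1" "k0 \<le> k"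
  shows "(\<Sum>s\<in>{s\<in>H. q < card s}. a (card s - 1)) \<le> (\<Sum>j=q..k0. real ((k + 1) choose (j + 1)) * a j)"
proof -
  let ?A = "{s. s \<subseteq> {0..k} \<and> q < card s \<and> card s \<le> k0 + 1}"
  have fin: "finite ?A" by (rule finite_subset[of _ "Pow {0..k}"]) auto
  have "(\<Sum>s\<in>{s\<in>H. q < card s}. a (card s - 1)) \<le> (\<Sum>s\<in>?A. a (card s - 1))"
    using assms q fin by (intro sum_mono2) (auto intro!: a_nonneg)
  also have "\<dots> = (\<Sum>j=q..k0. \<Sum>s\<in>{s\<in>?A. card s - 1 = j}. a (card s - 1))"
    by (rule sum.group[symmetric]) (use fin in auto)
  also have "\<dots> = (\<Sum>j=q..k0. real (card {s\<in>?A. card s - 1 = j}) * a j)"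
    by (intro sum.cong refl) simp
  also have "\<dots> = (\<Sum>j=q..k0. real ((k + 1) choose (j + 1)) * a j)"
  proof (intro sum.cong refl)
    fix j assume "j \<in> {q..k0}"
    then have "{s\<in>?A. card s - 1 = j} = {s. s \<subseteq> {0..k} \<and> card s = j + 1}" using q by auto
    then show "real (card {s\<in>?A. card s - 1 = j}) * a j = real ((k + 1) choose (j + 1)) * a j"
      by (simp add: n_subsets)
  qed
  finally show ?thesis .
qed

text \<open>The product of weights is what a random complex would give, so a sparse family holds no
  more images of \<open>H\<close> than expected, and fewer by a root of \<open>c\<close>. No
  injectivity on \<open>I\<close> is asked, as Finner's inequality runs over all functions in
  \<open>I \<rightarrow>\<^sub>E V\<close>; preserving the size of each member of \<open>H\<close>
  suffices both for the maps of a simplex and for the copies in the extremal parameter.\<close>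

lemma card_maps_into_sparse_le:
  fixes F :: "'v set set"
  assumes I: "I \<subseteq> {0..k}" and V: "finite V" "card V = n" "n \<ge> 1" and F: "finite F"
    and H: "H \<subseteq> Pow I" "s1 \<in> H" "q < card s1" and c: "0 \<le> c" "c \<le> 1"
    and sparse: "\<And>j. q \<le> j \<Longrightarrow> j \<le> k \<Longrightarrow>
      fact (k + 1) * real (card {t \<in> F. card t = j + 1}) \<le> c * real n powr (real q + 1 - B)"
  shows "real (card {f \<in> I \<rightarrow>\<^sub>E V. \<forall>s\<in>H. f ` s \<in> F \<and> card (f ` s) = card s})
    \<le> real n ^ card I * c powr (1 / (k choose q)) * (\<Prod>s\<in>H. simplex_weight (p n) s)"
proof -
  let ?D = "k choose q"
  have D: "?D \<ge> 1" using q by (simp add: Suc_le_eq)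
  have finI: "finite I" using I finite_subset by blast
  have finH: "finite H" using H(1) finI by (meson finite_Pow_iff finite_subset)
  have cardI: "card s \<le> k + 1" if "s \<subseteq> I" for s
    using card_mono[of "{0..k}" s] I that by auto
  have n: "real n > 0" using V by simp
  define X where "X s = {f \<in> I \<rightarrow>\<^sub>E V. f ` s \<in> F \<and> card (f ` s) = card s}" for s
  have finX: "finite (I \<rightarrow>\<^sub>E V)" using finI V by (simp add: finite_PiE)
  \<comment> \<open>The fraction of all maps that place \<open>s\<close> in \<open>F\<close>: of
    order \<open>c * n powr e\<close> target sets against \<open>n ^ (j + 1)\<close> possible
    values, which leaves the exponent \<open>q - j - B\<close>. The factorial in
    \<open>sparse\<close> pays for the orderings of the target.\<close>
  have X: "real (card (X s)) / real n ^ card I \<le> c * real n powr (real q - real j - B)"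
    if s: "s \<in> H" "card s = j + 1" "q \<le> j" for s j
  proof -
    have sI: "s \<subseteq> I" and jk: "j \<le> k" using s H(1) cardI[of s] by auto
    have "real (card (X s)) * real n ^ (j + 1)
        \<le> fact (j + 1) * real (card {t \<in> F. card t = j + 1}) * real n ^ card I"
      using card_maps_onto_simplex[OF finI V(1) F sI] s(2) V(2) unfolding X_def by simp
    also have "\<dots> \<le> fact (k + 1) * real (card {t \<in> F. card t = j + 1}) * real n ^ card I"
      using jk by (intro mult_right_mono fact_mono) auto
    also have "\<dots> \<le> c * real n powr (real q + 1 - B) * real n ^ card I"
      using sparse[OF s(3) jk] by (intro mult_right_mono) auto
    also have "real n powr (real q + 1 - B) = real n powr (real q - real j - B) * real n ^ (j + 1)"
      unfolding powr_realpow[OF n, symmetric] powr_add[symmetric] by (simp add: algebra_simps)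
    also have "c * (real n powr (real q - real j - B) * real n ^ (j + 1)) * real n ^ card I
        = (c * real n powr (real q - real j - B) * real n ^ card I) * real n ^ (j + 1)"
      by (simp only: mult_ac)
    finally have "real (card (X s)) \<le> c * real n powr (real q - real j - B) * real n ^ card I"
      by (rule mult_right_le_imp_le) (use n in simp)
    then show ?thesis using n by (simp add: divide_le_eq)
  qed
  let ?Z = "{f \<in> I \<rightarrow>\<^sub>E V. \<forall>s\<in>H. f ` s \<in> F \<and> card (f ` s) = card s}"
  \<comment> \<open>A member of largest size is singled out; its dimension \<open>k0\<close> decides
    which of the two arguments applies.\<close>
  have "Max (card ` H) \<in> card ` H" using finH H by (intro Max_in) auto
  then obtain s0 where "s0 \<in> H" "card s0 = Max (card ` H)" by auto
  then have s0: "s0 \<in> H" "\<And>s. s \<in> H \<Longrightarrow> card s \<le> card s0"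
    using finH by auto
  define k0 where "k0 = card s0 - 1"
  have "q < card s0" using s0(2)[OF H(2)] H(3) by simp
  then have k0: "card s0 = k0 + 1" "q \<le> k0" "\<And>s. s \<in> H \<Longrightarrow> card s \<le> k0 + 1"
    using s0 by (auto simp: k0_def)
  have k0k: "k0 \<le> k" using cardI[of s0] s0(1) H(1) k0(1) by auto
  have weight: "(\<Prod>s\<in>H. simplex_weight (p n) s)
      = real n powr - (\<Sum>s\<in>{s\<in>H. q < card s}. a (card s - 1))"
    using H(1) cardI by (intro prod_weight_eq V finH) auto
  have "real (card ?Z) / real n ^ card I \<le> c powr (1 / ?D) * (\<Prod>s\<in>H. simplex_weight (p n) s)"
  proof (cases "q < k0")
    case True
    have "real (card ?Z) / real n ^ card I \<le> real (card (X s0)) / real n ^ card I"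
      using s0(1) finX unfolding X_def
      by (intro divide_right_mono of_nat_mono card_mono) auto
    also have "\<dots> \<le> c * real n powr (real q - real k0 - B)"
      by (rule X[OF s0(1) k0(1,2)])
    also have "\<dots> \<le> c powr (1 / ?D) * (\<Prod>s\<in>H. simplex_weight (p n) s)"
    proof (rule mult_mono)
      \<comment> \<open>Here the count gives the full factor \<open>c\<close>; it is weakened to its
        root, which for \<open>c \<le> 1\<close> is larger, to match the other case.\<close>
      show "c \<le> c powr (1 / ?D)"
      proof (cases "c = 0")
        case False
        have "1 / real ?D \<le> 1" using D by (simp add: divide_le_eq)
        then show ?thesis using powr_mono'[of "1 / ?D" 1 c] c False by simp
      qed simp
      have "(\<Sum>s\<in>{s\<in>H. q < card s}. a (card s - 1)) \<le> real k0 - real q + B"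
      proof (rule order_trans[OF sum_exponents_le top[OF True k0k]])
        show "H \<subseteq> Pow {0..k}" using H(1) I by blast
      qed (use k0(3) k0k in auto)
      then show "real n powr (real q - real k0 - B) \<le> (\<Prod>s\<in>H. simplex_weight (p n) s)"
        unfolding weight using V by (intro powr_mono) auto
    qed auto
    finally show ?thesis .
  next
    case False
    then have k0q: "k0 = q" using k0 by simp
    define S where "S = {s \<in> H. q < card s}"
    have S: "card s = q + 1" "s \<in> H" "s \<subseteq> I" if "s \<in> S" for s
      using that k0(3)[of s] H(1) unfolding S_def k0q by auto
    have finS: "finite S" using finH by (simp add: S_def)
    have "s0 \<in> S" using s0(1) k0(1) k0q by (simp add: S_def)
    then have S1: "card S \<ge> 1" using finS by (auto simp: Suc_le_eq card_gt_0_iff)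
    \<comment> \<open>The factors are 0 or 1, so their roots multiply to the indicator that all of
      \<open>S\<close> is mapped into \<open>F\<close> with sizes preserved.\<close>
    let ?g = "\<lambda>s f. if f ` s \<in> F \<and> card (f ` s) = card s then 1 else (0::real)"
    have g: "(\<Prod>s\<in>S. ?g s f powr (1 / ?D)) = (if \<forall>s\<in>S. f ` s \<in> F \<and> card (f ` s) = card s then 1 else 0)" for f
      using finS by (auto intro!: prod.neutral)
    have sumg: "(\<Sum>f\<in>I \<rightarrow>\<^sub>E V. ?g s f) = card (X s)" for s
      using finX by (simp add: X_def sum.If_cases Int_def)
    have "real (card ?Z) \<le> real (card {f \<in> I \<rightarrow>\<^sub>E V. \<forall>s\<in>S. f ` s \<in> F \<and> card (f ` s) = card s})"
      using finX by (intro of_nat_mono card_mono) (auto simp: S_def)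
    also have "\<dots> = (\<Sum>f\<in>I \<rightarrow>\<^sub>E V. \<Prod>s\<in>S. ?g s f powr (1 / ?D))"
      unfolding g using finX by (simp add: sum.If_cases Int_def)
    finally have "real (card ?Z) / real n ^ card I
        \<le> (\<Sum>f\<in>I \<rightarrow>\<^sub>E V. \<Prod>s\<in>S. ?g s f powr (1 / ?D)) / real n ^ card I"
      by (rule divide_right_mono) simp
    also have "\<dots> \<le> (\<Prod>s\<in>S. ((\<Sum>f\<in>I \<rightarrow>\<^sub>E V. ?g s f) / real n ^ card I) powr (1 / ?D))"
      unfolding V(2)[symmetric]
    proof (rule Finner_average[where S = "\<lambda>s. s"])
      fix i assume "i \<in> I"
      have "card {j \<in> S. i \<in> j} \<le> card {s. s \<subseteq> {0..k} \<and> i \<in> s \<and> card s = Suc q}"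
      proof (rule card_mono)
        show "{j \<in> S. i \<in> j} \<subseteq> {s. s \<subseteq> {0..k} \<and> i \<in> s \<and> card s = Suc q}"
          using S(1,3) I by auto
        show "finite {s. s \<subseteq> {0..k} \<and> i \<in> s \<and> card s = Suc q}"
          by (rule finite_subset[of _ "Pow {0..k}"]) auto
      qed
      also have "\<dots> = ?D" using \<open>i \<in> I\<close> I by (subst card_subsets_containing) auto
      finally show "card {j \<in> S. i \<in> j} \<le> ?D" .
    next
      fix s and f f' :: "nat \<Rightarrow> 'v" assume "s \<in> S" "\<And>i. i \<in> s \<Longrightarrow> f i = f' i"
      then have "f ` s = f' ` s" by (intro image_cong refl)
      then show "?g s f = ?g s f'" by simp
    qed (use finI finS V D q(2) in auto)
    also have "\<dots> \<le> (\<Prod>s\<in>S. (c * real n powr - B) powr (1 / ?D))"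
      unfolding sumg
    proof (intro prod_mono conjI powr_mono2)
      fix s assume "s \<in> S"
      then show "real (card (X s)) / real n ^ card I \<le> c * real n powr - B"
        using X[OF S(2) S(1), of s] by simp
    qed auto
    also have "\<dots> = ((c * real n powr - B) powr (1 / ?D)) ^ card S" by simp
    \<comment> \<open>Since \<open>B / ?D = a q\<close>, Finner's root turns the density of images
      of one \<open>q\<close>-simplex into precisely its weight. Of the \<open>card S\<close> roots
      of \<open>c\<close> only one is kept below, which is legitimate because \<open>S\<close> is
      nonempty and \<open>c \<le> 1\<close>.\<close>
    also have "(c * real n powr - B) powr (1 / ?D) = c powr (1 / ?D) * real n powr - a q"
      using c q(2) by (simp add: powr_mult powr_powr)
    also have "(c powr (1 / ?D) * real n powr - a q) ^ card S
        \<le> c powr (1 / ?D) * (real n powr - a q) ^ card S"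
    proof -
      have "(c powr (1 / ?D)) ^ card S \<le> (c powr (1 / ?D)) ^ 1"
        using c S1 by (intro power_decreasing powr_le1) auto
      then show ?thesis unfolding power_mult_distrib by (intro mult_right_mono) auto
    qed
    also have "(real n powr - a q) ^ card S = (\<Prod>s\<in>H. simplex_weight (p n) s)"
    proof -
      have "(\<Sum>s\<in>S. a (card s - 1)) = real (card S) * a q" using S(1) by simp
      then show ?thesis
        unfolding weight S_def[symmetric]
        using n by (simp add: powr_realpow[symmetric] powr_powr mult.commute)
    qed
    finally show ?thesis .
  qed
  then show ?thesis using n by (simp add: divide_le_eq mult_ac)
qed

end

section \<open>Random complexes containing a given complex\<close>

lemma prob_superset_random_subset:
  assumes "finite A" "T \<subseteq> A" "0 \<le> r" "r \<le> 1"
  shows "measure_pmf.prob (random_subset A r) {S. T \<subseteq> S} = r ^ card T"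
proof -
  have "measure_pmf.prob (random_subset A r) {S. T \<subseteq> S}
      = measure_pmf.prob (Pi_pmf A False (\<lambda>_. bernoulli_pmf r)) (Pi A (\<lambda>x. if x \<in> T then {True} else UNIV))"
    unfolding random_subset_def measure_map_pmf
    using assms(2) by (intro arg_cong2[of _ _ _ _ measure] refl) (auto simp: Pi_iff split: if_splits)
  also have "\<dots> = (\<Prod>x\<in>A. if x \<in> T then r else 1)"
    unfolding measure_Pi_pmf_Pi[OF assms(1)] using assms(3,4)
    by (intro prod.cong refl) (auto simp: measure_pmf_single)
  also have "\<dots> = r ^ card T"
    using assms(1,2) by (simp add: prod.If_cases Int_absorb1)
  finally show ?thesis .
qed

lemma finite_potential_simplices: "finite (potential_simplices n i L)"
  unfolding potential_simplices_def by (rule finite_subset[of _ "Pow {1..n}"]) auto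

lemma set_random_subset:
  assumes "finite A"
  shows "set_pmf (random_subset A r) \<subseteq> Pow A"
  by (auto simp: random_subset_def)

lemma set_random_skeleton:
  assumes "K \<in> set_pmf (random_skeleton n p i)"
  shows "(\<lambda>v. {v}) ` {1..n} \<subseteq> K" "K \<subseteq> Pow {1..n}" "\<And>s. s \<in> K \<Longrightarrow> card s \<le> i + 1"
proof -
  have "(\<lambda>v. {v}) ` {1..n} \<subseteq> K \<and> K \<subseteq> Pow {1..n} \<and> (\<forall>s\<in>K. card s \<le> i + 1)"
    using assms
  proof (induction i arbitrary: K)
    case 0
    then show ?case by auto
  next
    case (Suc i)
    then obtain L S where L: "L \<in> set_pmf (random_skeleton n p i)" "K = L \<union> S"
        "S \<in> set_pmf (random_subset (potential_simplices n (Suc i) L) (p (Suc i)))"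
      by auto
    have "S \<subseteq> potential_simplices n (Suc i) L"
      using L(3) set_random_subset[OF finite_potential_simplices] by blast
    then have "S \<subseteq> Pow {1..n}" "\<forall>s\<in>S. card s \<le> Suc i + 1"
      by (auto simp: potential_simplices_def)
    moreover have "(\<lambda>v. {v}) ` {1..n} \<subseteq> L" "L \<subseteq> Pow {1..n}" "\<forall>s\<in>L. card s \<le> Suc i + 1"
      using Suc.IH[OF L(1)] by auto
    ultimately show ?case unfolding L(2) by blast
  qed
  then show "(\<lambda>v. {v}) ` {1..n} \<subseteq> K" "K \<subseteq> Pow {1..n}" "\<And>s. s \<in> K \<Longrightarrow> card s \<le> i + 1"
    by auto
qed

text \<open>Induction on the dimension. Given the skeleton \<open>K\<close>, the top layer
  \<open>Hi\<close> of \<open>L\<close> must be among the newly chosen simplices. Once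
  \<open>Lo \<subseteq> K\<close>, every member of \<open>Hi\<close> is a potential simplex because
  \<open>L\<close> is closed under faces, so this layer contributes a factor that does not depend on
  \<open>K\<close>.\<close>

lemma emeasure_random_skeleton_superset:
  assumes "\<And>i. 0 \<le> p i \<and> p i \<le> 1"
    and "abstract_complex L" "L \<subseteq> Pow {1..n}" "\<And>s. s \<in> L \<Longrightarrow> card s \<le> i + 1"
  shows "emeasure (random_skeleton n p i) {K. L \<subseteq> K} = ennreal (\<Prod>s\<in>L. simplex_weight p s)"
  using assms(2-)
proof (induction i arbitrary: L)
  case 0
  have "L \<subseteq> (\<lambda>v. {v}) ` {1..n}"
  proof
    fix s assume s: "s \<in> L"
    have "finite s" "s \<noteq> {}" using s 0(1) by (simp_all add: abstract_complex_def)
    then have "card s = 1" using 0(3)[OF s] by (simp add: le_Suc_eq)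
    then obtain v where "s = {v}" by (auto simp: card_1_singleton_iff)
    then show "s \<in> (\<lambda>v. {v}) ` {1..n}" using s 0(2) by auto
  qed
  moreover have "(\<Prod>s\<in>L. simplex_weight p s) = 1"
    using 0(3) by (intro prod.neutral) (auto simp: simplex_weight_def)
  ultimately show ?case by simp
next
  case (Suc i)
  define Lo where "Lo = {s \<in> L. card s \<le> i + 1}"
  define Hi where "Hi = {s \<in> L. card s = i + 2}"
  have L: "L = Lo \<union> Hi" "Lo \<inter> Hi = {}"
    unfolding Lo_def Hi_def using Suc.prems(3) by fastforce+
  have finL: "finite L" using Suc.prems(1) by (simp add: abstract_complex_def)
  have cLo: "abstract_complex Lo"
    using Suc.prems(1) unfolding abstract_complex_def Lo_def
    by (auto intro: order_trans[OF card_mono])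
  have step: "emeasure (map_pmf (\<lambda>S. K \<union> S) (random_subset (potential_simplices n (Suc i) K) (p (Suc i)))) {K. L \<subseteq> K}
      = ennreal (p (Suc i) ^ card Hi) * indicator {K. Lo \<subseteq> K} K"
    if K: "K \<in> set_pmf (random_skeleton n p i)" for K
  proof -
    let ?A = "potential_simplices n (Suc i) K"
    \<comment> \<open>Sizes separate old from new: \<open>K\<close> has no set of size
      \<open>i + 2\<close>, while all potential simplices have exactly that size.\<close>
    have disj: "Hi \<inter> K = {}" using set_random_skeleton(3)[OF K] by (fastforce simp: Hi_def)
    have disjA: "Lo \<inter> ?A = {}" by (auto simp: Lo_def potential_simplices_def)
    have iff: "L \<subseteq> K \<union> S \<longleftrightarrow> Lo \<subseteq> K \<and> Hi \<subseteq> S" if "S \<subseteq> ?A" for S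
      using that L disj disjA by blast
    have "emeasure (map_pmf (\<lambda>S. K \<union> S) (random_subset ?A (p (Suc i)))) {K. L \<subseteq> K}
        = emeasure (random_subset ?A (p (Suc i))) {S. Lo \<subseteq> K \<and> Hi \<subseteq> S}"
      unfolding emeasure_map_pmf
    proof (rule emeasure_eq_AE)
      show "AE S in random_subset ?A (p (Suc i)).
          S \<in> (\<lambda>S. K \<union> S) -` {K. L \<subseteq> K} \<longleftrightarrow> S \<in> {S. Lo \<subseteq> K \<and> Hi \<subseteq> S}"
      proof (rule AE_pmfI)
        fix S assume "S \<in> set_pmf (random_subset ?A (p (Suc i)))"
        then have "S \<subseteq> ?A" using set_random_subset[OF finite_potential_simplices] by blast
        then show "S \<in> (\<lambda>S. K \<union> S) -` {K. L \<subseteq> K} \<longleftrightarrow> S \<in> {S. Lo \<subseteq> K \<and> Hi \<subseteq> S}"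
          by (simp add: iff)
      qed
    qed auto
    also have "\<dots> = ennreal (p (Suc i) ^ card Hi) * indicator {K. Lo \<subseteq> K} K"
    proof (cases "Lo \<subseteq> K")
      case True
      have "Hi \<subseteq> ?A"
      proof
        fix s assume s: "s \<in> Hi"
        have fs: "finite s" using s Suc.prems(1) by (auto simp: Hi_def abstract_complex_def)
        have "t \<in> K" if t: "t \<subset> s" "t \<noteq> {}" for t
        proof -
          have "t \<in> L" using t s Suc.prems(1) unfolding abstract_complex_def Hi_def by blast
          moreover have "card t < card s" by (rule psubset_card_mono[OF fs t(1)])
          ultimately show ?thesis using s True by (auto simp: Hi_def Lo_def)
        qed
        then show "s \<in> ?A"
          using s Suc.prems(2) unfolding potential_simplices_def Hi_def by auto
      qed
      then show ?thesis
        using True assms(1)[of "Suc i"] prob_superset_random_subset[OF finite_potential_simplices]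
        by (simp add: measure_pmf.emeasure_eq_measure)
    qed simp
    finally show ?thesis .
  qed
  have "emeasure (random_skeleton n p (Suc i)) {K. L \<subseteq> K}
      = (\<integral>\<^sup>+K. ennreal (p (Suc i) ^ card Hi) * indicator {K. Lo \<subseteq> K} K \<partial>random_skeleton n p i)"
    unfolding random_skeleton.simps emeasure_bind_pmf
    by (intro nn_integral_cong_AE AE_pmfI step)
  also have "\<dots> = ennreal (p (Suc i) ^ card Hi) * emeasure (random_skeleton n p i) {K. Lo \<subseteq> K}"
    by (subst nn_integral_cmult_indicator) auto
  also have "emeasure (random_skeleton n p i) {K. Lo \<subseteq> K} = ennreal (\<Prod>s\<in>Lo. simplex_weight p s)"
    by (intro Suc.IH cLo) (use Suc.prems(2) in \<open>auto simp: Lo_def\<close>)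
  also have "ennreal (p (Suc i) ^ card Hi) * \<dots> = ennreal (p (Suc i) ^ card Hi * (\<Prod>s\<in>Lo. simplex_weight p s))"
    using assms(1) by (intro ennreal_mult[symmetric] prod_nonneg) (auto simp: simplex_weight_def)
  also have "p (Suc i) ^ card Hi = (\<Prod>s\<in>Hi. simplex_weight p s)"
    by (simp add: simplex_weight_def Hi_def)
  also have "(\<Prod>s\<in>Hi. simplex_weight p s) * (\<Prod>s\<in>Lo. simplex_weight p s) = (\<Prod>s\<in>L. simplex_weight p s)"
    using finL L by (metis finite_Un mult.commute prod.union_disjoint)
  finally show ?case .
qed

lemma prob_random_complex_superset:
  assumes "\<And>i. 0 \<le> p i \<and> p i \<le> 1" "abstract_complex L" "L \<subseteq> Pow {1..n}" "n \<ge> 1"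
  shows "measure_pmf.prob (random_complex n p) {K. L \<subseteq> K} = (\<Prod>s\<in>L. simplex_weight p s)"
proof -
  have "card s \<le> n - 1 + 1" if "s \<in> L" for s
    using card_mono[of "{1..n}" s] that assms(3,4) by auto
  then have "emeasure (random_complex n p) {K. L \<subseteq> K} = ennreal (\<Prod>s\<in>L. simplex_weight p s)"
    unfolding random_complex_def by (rule emeasure_random_skeleton_superset[OF assms(1-3)])
  moreover have "0 \<le> (\<Prod>s\<in>L. simplex_weight p s)"
    using assms(1) by (intro prod_nonneg) (simp add: simplex_weight_def)
  ultimately show ?thesis by (simp add: measure_def)
qed

section \<open>Copies of a simplex in the random complex\<close>

definition simplex_maps :: "nat \<Rightarrow> nat \<Rightarrow> (nat \<Rightarrow> nat) set" where
  "simplex_maps n k = {f \<in> {0..k} \<rightarrow>\<^sub>E {1..n}. inj_on f {0..k}}"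

definition image_complex :: "nat \<Rightarrow> (nat \<Rightarrow> nat) \<Rightarrow> nat set set" where
  "image_complex k f = (\<lambda>s. f ` s) ` std_simplex k"

lemma finite_simplex_maps: "finite (simplex_maps n k)"
  unfolding simplex_maps_def by (rule finite_subset[OF Collect_restrict]) (auto intro: finite_PiE)

lemma finite_std_simplex: "finite (std_simplex k)"
  unfolding std_simplex_def by (rule finite_subset[of _ "Pow {0..k}"]) auto

lemma Union_std_simplex: "\<Union>(std_simplex k) = {0..k}"
  by (auto simp: std_simplex_def)

lemma image_complex_eq: "image_complex k f = Pow (f ` {0..k}) - {{}}"
proof (intro equalityI subsetI)
  fix t assume "t \<in> Pow (f ` {0..k}) - {{}}"
  then obtain s where "s \<subseteq> {0..k}" "t = f ` s" "t \<noteq> {}" by (auto simp: subset_image_iff)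
  then show "t \<in> image_complex k f" by (auto simp: image_complex_def std_simplex_def)
qed (auto simp: image_complex_def std_simplex_def)

lemma abstract_complex_image_complex: "abstract_complex (image_complex k f)"
  unfolding abstract_complex_def image_complex_eq
  by (auto intro: finite_subset[of _ "f ` {0..k}"])

lemma abstract_complex_Un:
  "abstract_complex K \<Longrightarrow> abstract_complex L \<Longrightarrow> abstract_complex (K \<union> L)"
  unfolding abstract_complex_def by (intro conjI) (simp, blast, blast)

lemma abstract_complex_empty: "abstract_complex {}"
  by (simp add: abstract_complex_def)

lemma image_complex_subset: "f \<in> simplex_maps n k \<Longrightarrow> image_complex k f \<subseteq> Pow {1..n}"
  unfolding image_complex_eq simplex_maps_def by (auto simp: PiE_def Pi_def)

lemma finite_set_random_complex: "finite (set_pmf (random_complex n p))"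
  unfolding random_complex_def
proof (rule finite_subset)
  show "set_pmf (random_skeleton n p (n - 1)) \<subseteq> Pow (Pow {1..n})"
  proof
    fix K assume "K \<in> set_pmf (random_skeleton n p (n - 1))"
    then show "K \<in> Pow (Pow {1..n})" using set_random_skeleton(2) by (intro PowI)
  qed
qed simp

lemma integrable_random_complex: "integrable (random_complex n p) (f :: _ \<Rightarrow> real)"
  by (rule integrable_measure_pmf_finite[OF finite_set_random_complex])

text \<open>Every vertex of \<open>{1..n}\<close> is present in every outcome, so the candidate maps
  form a fixed set and the count becomes a sum of indicators of containment events.\<close>

lemma ordered_copies_std_simplex:
  assumes "K \<in> set_pmf (random_complex n p)"
  shows "real (ordered_copies K (std_simplex k))
    = (\<Sum>f\<in>simplex_maps n k. indicator {K. image_complex k f \<subseteq> K} K)"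
proof -
  have "\<Union>K = {1..n}"
  proof (intro equalityI)
    show "\<Union>K \<subseteq> {1..n}"
      using set_random_skeleton(2) assms unfolding random_complex_def by blast
    show "{1..n} \<subseteq> \<Union>K"
      using set_random_skeleton(1) assms unfolding random_complex_def by blast
  qed
  then have "{f \<in> \<Union>(std_simplex k) \<rightarrow>\<^sub>E \<Union>K. inj_on f (\<Union>(std_simplex k)) \<and> (\<forall>s\<in>std_simplex k. f ` s \<in> K)}
      = simplex_maps n k \<inter> {f. image_complex k f \<subseteq> K}"
    by (auto simp: Union_std_simplex simplex_maps_def image_complex_def)
  then show ?thesis
    using finite_simplex_maps[of n k] unfolding ordered_copies_def
    by (simp add: indicator_def sum.If_cases)
qed

text \<open>This deterministic bound later turns a large expectation into a lower bound on a
  probability.\<close>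

lemma ordered_copies_le:
  assumes "K \<in> set_pmf (random_complex n p)"
  shows "real (ordered_copies K (std_simplex k)) \<le> real n ^ (k + 1)"
proof -
  have "real (ordered_copies K (std_simplex k)) \<le> (\<Sum>f\<in>simplex_maps n k. 1)"
    unfolding ordered_copies_std_simplex[OF assms] by (intro sum_mono) (auto simp: indicator_def)
  also have "\<dots> = real (card (simplex_maps n k))" by simp
  also have "card (simplex_maps n k) \<le> card ({0..k} \<rightarrow>\<^sub>E {1..n})"
    unfolding simplex_maps_def by (intro card_mono finite_PiE) auto
  finally show ?thesis by (simp add: card_PiE)
qed

text \<open>One factor of the power is expanded into indicators, and the containments of
  \<open>L\<close> and of the new copy merge into a single one. Iterating from \<open>L = {}\<close>
  builds a union of \<open>l\<close> copies one at a time; with \<open>l = 0\<close> the identity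
  yields first moments.\<close>

lemma expectation_power_step:
  assumes p: "\<And>i. 0 \<le> p i \<and> p i \<le> 1" and "n \<ge> 1"
  shows "measure_pmf.expectation (random_complex n p)
      (\<lambda>K. indicator {K. L \<subseteq> K} K * real (ordered_copies K (std_simplex k)) ^ Suc l)
    = (\<Sum>f\<in>simplex_maps n k. measure_pmf.expectation (random_complex n p)
      (\<lambda>K. indicator {K. L \<union> image_complex k f \<subseteq> K} K * real (ordered_copies K (std_simplex k)) ^ l))"
proof -
  have "measure_pmf.expectation (random_complex n p)
      (\<lambda>K. indicator {K. L \<subseteq> K} K * real (ordered_copies K (std_simplex k)) ^ Suc l)
    = measure_pmf.expectation (random_complex n p) (\<lambda>K. \<Sum>f\<in>simplex_maps n k.
        indicator {K. L \<union> image_complex k f \<subseteq> K} K * real (ordered_copies K (std_simplex k)) ^ l)"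
  proof (intro integral_cong_AE AE_pmfI)
    fix K assume "K \<in> set_pmf (random_complex n p)"
    note N = ordered_copies_std_simplex[OF this, of k]
    let ?N = "real (ordered_copies K (std_simplex k))"
    have "indicator {K. L \<subseteq> K} K * ?N ^ Suc l = (indicator {K. L \<subseteq> K} K * ?N ^ l) * ?N"
      by (simp add: mult_ac)
    also have "\<dots> = (indicator {K. L \<subseteq> K} K * ?N ^ l) * (\<Sum>f\<in>simplex_maps n k. indicator {K. image_complex k f \<subseteq> K} K)"
      by (subst N[symmetric]) simp
    also have "\<dots> = (\<Sum>f\<in>simplex_maps n k. indicator {K. L \<union> image_complex k f \<subseteq> K} K * ?N ^ l)"
      unfolding sum_distrib_left by (intro sum.cong refl) (simp add: indicator_def)
    finally show "indicator {K. L \<subseteq> K} K * ?N ^ Suc l = (\<Sum>f\<in>simplex_maps n k. indicator {K. L \<union> image_complex k f \<subseteq> K} K * ?N ^ l)" .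
  qed auto
  also have "\<dots> = (\<Sum>f\<in>simplex_maps n k. measure_pmf.expectation (random_complex n p)
      (\<lambda>K. indicator {K. L \<union> image_complex k f \<subseteq> K} K * real (ordered_copies K (std_simplex k)) ^ l))"
    by (intro Bochner_Integration.integral_sum integrable_random_complex)
  finally show ?thesis .
qed

lemma expectation_indicator_superset:
  assumes p: "\<And>i. 0 \<le> p i \<and> p i \<le> 1" and "n \<ge> 1" "abstract_complex L" "L \<subseteq> Pow {1..n}"
  shows "measure_pmf.expectation (random_complex n p) (indicator {K. L \<subseteq> K}) = (\<Prod>s\<in>L. simplex_weight p s)"
  unfolding prob_random_complex_superset[OF p assms(3,4,2), symmetric] by simp

lemma card_simplex_maps: "card (simplex_maps n k) = (\<Prod>i=0..<k+1. n - i)"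
proof -
  have "card (simplex_maps n k) = (\<Prod>i=0..<card {0..k}. card {1..n} - i)"
    unfolding simplex_maps_def by (subst card_inj_on_subset_funcset) auto
  then show ?thesis by simp
qed

lemma power_le_card_simplex_maps:
  assumes "2 * k \<le> n"
  shows "real n ^ (k + 1) \<le> 2 ^ (k + 1) * real (card (simplex_maps n k))"
proof -
  have "real n ^ (k + 1) = (\<Prod>i=0..<k+1. real n)" by simp
  also have "\<dots> \<le> (\<Prod>i=0..<k+1. 2 * real (n - i))"
    using assms by (intro prod_mono) (auto simp: of_nat_diff)
  also have "\<dots> = (\<Prod>i=0..<k+1. 2) * (\<Prod>i=0..<k+1. real (n - i))" by (rule prod.distrib)
  also have "\<dots> = 2 ^ (k + 1) * real (card (simplex_maps n k))"
    unfolding card_simplex_maps by simp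
  finally show ?thesis .
qed

lemma card_image_simplex_maps:
  assumes "f \<in> simplex_maps n k" "s \<subseteq> {0..k}"
  shows "card (f ` s) = card s"
  using assms unfolding simplex_maps_def by (auto intro: card_image inj_on_subset)

lemma inj_on_image_simplex_maps:
  assumes "f \<in> simplex_maps n k"
  shows "inj_on ((`) f) (std_simplex k)"
proof (rule inj_on_subset)
  show "inj_on ((`) f) (Pow {0..k})"
    using assms by (intro inj_on_image_Pow) (simp add: simplex_maps_def)
qed (auto simp: std_simplex_def)

lemma simplex_weight_image:
  assumes "f \<in> simplex_maps n k" "s \<in> std_simplex k"
  shows "simplex_weight p (f ` s) = simplex_weight p s"
  using card_image_simplex_maps[OF assms(1), of s] assms(2)
  by (simp add: simplex_weight_def std_simplex_def)

lemma prod_weight_image_complex: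
  assumes "f \<in> simplex_maps n k"
  shows "(\<Prod>t\<in>image_complex k f. simplex_weight p t) = (\<Prod>s\<in>std_simplex k. simplex_weight p s)"
  unfolding image_complex_def prod.reindex[OF inj_on_image_simplex_maps[OF assms]]
  by (intro prod.cong refl) (simp add: simplex_weight_image[OF assms])

lemma card_std_simplex: "card {s \<in> std_simplex k. card s = j + 1} = (k + 1) choose (j + 1)"
proof -
  have "{s \<in> std_simplex k. card s = j + 1} = {s. s \<subseteq> {0..k} \<and> card s = j + 1}"
    by (auto simp: std_simplex_def)
  then show ?thesis by (simp add: n_subsets)
qed

lemma card_image_complex:
  assumes "f \<in> simplex_maps n k"
  shows "card {t \<in> image_complex k f. card t = j + 1} = (k + 1) choose (j + 1)"
proof -
  have "{t \<in> image_complex k f. card t = j + 1} = (`) f ` {s \<in> std_simplex k. card s = j + 1}"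
    using card_image_simplex_maps[OF assms] by (auto simp: image_complex_def std_simplex_def)
  moreover have "inj_on ((`) f) {s \<in> std_simplex k. card s = j + 1}"
    by (rule inj_on_subset[OF inj_on_image_simplex_maps[OF assms]]) auto
  ultimately show ?thesis using card_std_simplex by (simp add: card_image)
qed

lemma expected_ordered_copies_eq:
  assumes "\<And>i. 0 \<le> p i \<and> p i \<le> 1" "n \<ge> 1"
  shows "expected_ordered_copies n p (std_simplex k)
    = real (card (simplex_maps n k)) * (\<Prod>s\<in>std_simplex k. simplex_weight p s)"
proof -
  have "expected_ordered_copies n p (std_simplex k)
      = (\<Sum>f\<in>simplex_maps n k. measure_pmf.expectation (random_complex n p)
          (indicator {K. image_complex k f \<subseteq> K}))"
    using expectation_power_step[OF assms, where L = "{}" and k = k and l = 0]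
    by (simp add: expected_ordered_copies_def)
  also have "\<dots> = (\<Sum>f\<in>simplex_maps n k. \<Prod>s\<in>std_simplex k. simplex_weight p s)"
  proof (rule sum.cong[OF refl])
    fix f assume f: "f \<in> simplex_maps n k"
    show "measure_pmf.expectation (random_complex n p) (indicator {K. image_complex k f \<subseteq> K})
        = (\<Prod>s\<in>std_simplex k. simplex_weight p s)"
      unfolding expectation_indicator_superset[OF assms abstract_complex_image_complex image_complex_subset[OF f]]
      by (rule prod_weight_image_complex[OF f])
  qed
  finally show ?thesis by simp
qed

section \<open>Moments of the number of copies\<close>

context clique_exponents
begin

abbreviation "e \<equiv> real q + 1 - B"

lemma simplex_weight_pos: "n \<ge> 1 \<Longrightarrow> card s \<le> k + 1 \<Longrightarrow> simplex_weight (p n) s > 0"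
  by (simp add: simplex_weight_eq)

lemma simplex_weight_le_1: "n \<ge> 1 \<Longrightarrow> simplex_weight (p n) s \<le> 1"
  using p_bounds by (simp add: simplex_weight_def)

lemma card_std_simplex_le: "s \<in> std_simplex k \<Longrightarrow> card s \<le> k + 1"
  using card_mono[of "{0..k}" s] by (simp add: std_simplex_def)

abbreviation "W n \<equiv> \<Prod>s\<in>std_simplex k. simplex_weight (p n) s"

lemma W_pos: "n \<ge> 1 \<Longrightarrow> W n > 0"
  by (intro prod_pos simplex_weight_pos card_std_simplex_le)

text \<open>A further copy only pays for simplices that are not yet in \<open>L\<close>, so it gains
  the inverse weight of the faces it shares with \<open>L\<close>. Sorted by the family of shared
  faces of dimension at least \<open>q\<close>, the gain is balanced by the small number of maps
  sharing that family. The empty family gives the main term, and \<open>2 ^ (2 ^ (k + 1))\<close>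
  bounds the number of the others.\<close>

lemma sum_weight_Un_image_complex_le:
  assumes n: "n \<ge> 1" and c: "0 \<le> c" "c \<le> 1" and L: "abstract_complex L"
    and sparse: "\<And>j. q \<le> j \<Longrightarrow> j \<le> k \<Longrightarrow>
      fact (k + 1) * real (card {t \<in> L. card t = j + 1}) \<le> c * real n powr e"
  shows "(\<Sum>f\<in>simplex_maps n k. \<Prod>s\<in>L \<union> image_complex k f. simplex_weight (p n) s)
    \<le> (\<Prod>s\<in>L. simplex_weight (p n) s) * W n
      * (real (card (simplex_maps n k)) + 2 ^ (2 ^ (k + 1)) * real n ^ (k + 1) * c powr (1 / (k choose q)))"
proof -
  let ?w = "simplex_weight (p n) :: nat set \<Rightarrow> real"
  define T where "T = {s \<in> std_simplex k. q < card s}"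
  have finT: "finite T" using finite_std_simplex by (simp add: T_def)
  have wpos: "?w s > 0" if "s \<in> std_simplex k" for s
    by (intro simplex_weight_pos n card_std_simplex_le that)
  have wH: "(\<Prod>s\<in>H. ?w s) > 0" if "H \<subseteq> std_simplex k" for H
    using that wpos by (intro prod_pos) auto
  let ?hit = "\<lambda>H f. \<forall>s\<in>H. f ` s \<in> L \<and> card (f ` s) = card s"
  have finL: "finite L" using L by (simp add: abstract_complex_def)
  \<comment> \<open>The simplices of dimension at least \<open>q\<close> that \<open>f\<close> maps into \<open>L\<close> form one of the families \<open>H\<close>.\<close>
  have point: "(\<Prod>s\<in>L \<union> image_complex k f. ?w s)
      \<le> (\<Prod>s\<in>L. ?w s) * W n * (1 + (\<Sum>H\<in>Pow T - {{}}. (if ?hit H f then 1 else 0) / (\<Prod>s\<in>H. ?w s)))"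
    if f: "f \<in> simplex_maps n k" for f
  proof -
    let ?S = "{s \<in> std_simplex k. f ` s \<in> L}"
    define H where "H = {s \<in> T. f ` s \<in> L}"
    have sub: "H \<subseteq> ?S" "H \<in> Pow T" "H \<subseteq> std_simplex k" by (auto simp: H_def T_def)
    have fin: "finite (image_complex k f)"
      using finite_std_simplex by (simp add: image_complex_def)
    have "(\<Prod>s\<in>image_complex k f \<inter> L. ?w s) = (\<Prod>s\<in>?S. ?w (f ` s))"
    proof -
      have "image_complex k f \<inter> L = (`) f ` ?S" by (auto simp: image_complex_def)
      moreover have "inj_on ((`) f) ?S"
        by (rule inj_on_subset[OF inj_on_image_simplex_maps[OF f]]) auto
      ultimately show ?thesis by (simp add: prod.reindex)
    qed
    also have "\<dots> = (\<Prod>s\<in>?S. ?w s)"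
      by (intro prod.cong refl) (simp add: simplex_weight_image[OF f])
    also have "\<dots> = (\<Prod>s\<in>H. ?w s)"
    proof (rule prod.mono_neutral_right[OF _ sub(1)])
      show "\<forall>s\<in>?S - H. ?w s = 1"
        using n card_std_simplex_le by (auto simp: H_def T_def simplex_weight_eq)
    qed (use finite_std_simplex in simp)
    finally have int: "(\<Prod>s\<in>image_complex k f \<inter> L. ?w s) = (\<Prod>s\<in>H. ?w s)" .
    have "(\<Prod>s\<in>image_complex k f. ?w s)
        = (\<Prod>s\<in>image_complex k f \<inter> L. ?w s) * (\<Prod>s\<in>image_complex k f - L. ?w s)"
      using fin by (rule prod.Int_Diff)
    then have diff: "(\<Prod>s\<in>image_complex k f - L. ?w s) = W n / (\<Prod>s\<in>H. ?w s)"
      using wH[OF sub(3)] unfolding prod_weight_image_complex[OF f] int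
      by (simp add: field_simps)
    have "(\<Prod>s\<in>L \<union> image_complex k f. ?w s) = (\<Prod>s\<in>L. ?w s) * (\<Prod>s\<in>image_complex k f - L. ?w s)"
      using prod.union_disjoint[of L "image_complex k f - L" ?w] fin finL by simp
    also have "\<dots> = (\<Prod>s\<in>L. ?w s) * W n * (1 / (\<Prod>s\<in>H. ?w s))"
      unfolding diff by simp
    \<comment> \<open>The family belonging to \<open>f\<close> is one of the summands, or it is
      empty and covered by the 1. Summing over all families removes the dependence on
      \<open>f\<close> of the index set, so that the two sums can be exchanged.\<close>
    also have "\<dots> \<le> (\<Prod>s\<in>L. ?w s) * W n * (1 + (\<Sum>H\<in>Pow T - {{}}. (if ?hit H f then 1 else 0) / (\<Prod>s\<in>H. ?w s)))"
    proof (rule mult_left_mono)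
      have nn: "0 \<le> (if ?hit H f then 1 else 0) / (\<Prod>s\<in>H. ?w s)" if "H \<in> Pow T - {{}}" for H
      proof -
        have "H \<subseteq> std_simplex k" using that by (auto simp: T_def)
        from wH[OF this] show ?thesis by simp
      qed
      show "1 / (\<Prod>s\<in>H. ?w s) \<le> 1 + (\<Sum>H\<in>Pow T - {{}}. (if ?hit H f then 1 else 0) / (\<Prod>s\<in>H. ?w s))"
      proof (cases "H = {}")
        case True
        have "0 \<le> (\<Sum>H\<in>Pow T - {{}}. (if ?hit H f then 1 else 0) / (\<Prod>s\<in>H. ?w s))"
          by (rule sum_nonneg) (rule nn)
        then show ?thesis using True by simp
      next
        case False
        have "?hit H f"
          using card_image_simplex_maps[OF f] by (auto simp: H_def T_def std_simplex_def)
        then have "1 / (\<Prod>s\<in>H. ?w s) = (if ?hit H f then 1 else 0) / (\<Prod>s\<in>H. ?w s)" by simp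
        also have "\<dots> \<le> (\<Sum>H\<in>Pow T - {{}}. (if ?hit H f then 1 else 0) / (\<Prod>s\<in>H. ?w s))"
          using False sub(2) finT nn by (intro member_le_sum) auto
        finally show ?thesis by simp
      qed
      show "0 \<le> (\<Prod>s\<in>L. ?w s) * W n"
        using p_bounds[OF n] W_pos[OF n]
        by (intro mult_nonneg_nonneg prod_nonneg) (auto simp: simplex_weight_def)
    qed
    finally show ?thesis .
  qed
  \<comment> \<open>The weight of \<open>H\<close> in the count of maps cancels the gain in the
    denominator, so all families satisfy the same bound.\<close>
  have hits: "(\<Sum>f\<in>simplex_maps n k. (if ?hit H f then 1 else 0) / (\<Prod>s\<in>H. ?w s))
      \<le> real n ^ (k + 1) * c powr (1 / (k choose q))" if H: "H \<in> Pow T - {{}}" for H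
  proof -
    obtain s1 where s1: "s1 \<in> H" "q < card s1" using H by (auto simp: T_def)
    have HI: "H \<subseteq> Pow {0..k}" using H by (auto simp: T_def std_simplex_def)
    have w: "(\<Prod>s\<in>H. ?w s) > 0" using H by (intro wH) (auto simp: T_def)
    have "(\<Sum>f\<in>simplex_maps n k. if ?hit H f then 1 else 0) = real (card {f \<in> simplex_maps n k. ?hit H f})"
      using finite_simplex_maps[of n k] by (simp add: sum.If_cases Int_def)
    also have "\<dots> \<le> real (card {f \<in> {0..k} \<rightarrow>\<^sub>E {1..n}. ?hit H f})"
      unfolding simplex_maps_def
      by (intro of_nat_mono card_mono finite_subset[OF Collect_restrict] finite_PiE) auto
    also have "\<dots> \<le> real n ^ card {0..k} * c powr (1 / (k choose q)) * (\<Prod>s\<in>H. ?w s)"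
      by (rule card_maps_into_sparse_le[OF _ _ _ n finL HI s1 c sparse]) auto
    finally show ?thesis using w unfolding sum_divide_distrib[symmetric]
      by (simp add: divide_le_eq)
  qed
  have "(\<Sum>f\<in>simplex_maps n k. \<Prod>s\<in>L \<union> image_complex k f. ?w s)
      \<le> (\<Sum>f\<in>simplex_maps n k. (\<Prod>s\<in>L. ?w s) * W n * (1 + (\<Sum>H\<in>Pow T - {{}}. (if ?hit H f then 1 else 0) / (\<Prod>s\<in>H. ?w s))))"
    by (intro sum_mono point)
  also have "\<dots> = (\<Prod>s\<in>L. ?w s) * W n * (real (card (simplex_maps n k))
      + (\<Sum>H\<in>Pow T - {{}}. \<Sum>f\<in>simplex_maps n k. (if ?hit H f then 1 else 0) / (\<Prod>s\<in>H. ?w s)))"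
    unfolding sum_distrib_left[symmetric] sum.distrib by (subst sum.swap) simp
  also have "\<dots> \<le> (\<Prod>s\<in>L. ?w s) * W n * (real (card (simplex_maps n k))
      + 2 ^ (2 ^ (k + 1)) * real n ^ (k + 1) * c powr (1 / (k choose q)))"
  proof (intro mult_left_mono add_left_mono)
    have "(\<Sum>H\<in>Pow T - {{}}. \<Sum>f\<in>simplex_maps n k. (if ?hit H f then 1 else 0) / (\<Prod>s\<in>H. ?w s))
        \<le> real (card (Pow T - {{}})) * (real n ^ (k + 1) * c powr (1 / (k choose q)))"
      by (rule sum_bounded_above) (rule hits)
    also have "\<dots> \<le> 2 ^ (2 ^ (k + 1)) * (real n ^ (k + 1) * c powr (1 / (k choose q)))"
    proof (intro mult_right_mono)
      have "card (Pow T - {{}}) \<le> card (Pow (Pow {0..k}))"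
        by (intro card_mono) (auto simp: T_def std_simplex_def)
      then have "card (Pow T - {{}}) \<le> 2 ^ (2 ^ (k + 1))" by (simp add: card_Pow)
      then have "real (card (Pow T - {{}})) \<le> real (2 ^ (2 ^ (k + 1)))" by (rule of_nat_mono)
      then show "real (card (Pow T - {{}})) \<le> 2 ^ (2 ^ (k + 1))" by simp
    qed auto
    finally show "(\<Sum>H\<in>Pow T - {{}}. \<Sum>f\<in>simplex_maps n k. (if ?hit H f then 1 else 0) / (\<Prod>s\<in>H. ?w s))
        \<le> 2 ^ (2 ^ (k + 1)) * real n ^ (k + 1) * c powr (1 / (k choose q))" by (simp add: mult.assoc)
    show "0 \<le> (\<Prod>s\<in>L. ?w s) * W n"
      using p_bounds[OF n] W_pos[OF n]
      by (intro mult_nonneg_nonneg prod_nonneg) (auto simp: simplex_weight_def)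
  qed
  finally show ?thesis .
qed

text \<open>Induction on \<open>l\<close>, where \<open>L\<close> is the union of the copies chosen
  so far. The last hypothesis reserves room for \<open>2 ^ (k + 1)\<close> simplices of each size
  for every copy still to come, so it passes to \<open>L \<union> image_complex k f\<close> with one
  copy fewer and keeps the same \<open>c\<close> at every stage.\<close>

lemma moment_le:
  assumes n: "n \<ge> 1" "2 * k \<le> n" and c: "0 \<le> c" "c \<le> 1"
    and "abstract_complex L" "L \<subseteq> Pow {1..n}"
    and "\<And>j. q \<le> j \<Longrightarrow> j \<le> k \<Longrightarrow>
      fact (k + 1) * (real (card {t \<in> L. card t = j + 1}) + real l * 2 ^ (k + 1)) \<le> c * real n powr e"
  shows "measure_pmf.expectation (random_complex n (p n))
      (\<lambda>K. indicator {K. L \<subseteq> K} K * real (ordered_copies K (std_simplex k)) ^ l)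
    \<le> (\<Prod>s\<in>L. simplex_weight (p n) s)
      * ((1 + 2 ^ (2 ^ (k + 1)) * 2 ^ (k + 1) * c powr (1 / (k choose q)))
         * expected_ordered_copies n (p n) (std_simplex k)) ^ l"
  using assms(5-)
proof (induction l arbitrary: L)
  case 0
  then show ?case
    using expectation_indicator_superset[OF p_bounds[OF n(1)] n(1) 0(1,2)] by simp
next
  case (Suc l)
  let ?mu = "expected_ordered_copies n (p n) (std_simplex k)"
  let ?x = "c powr (1 / (k choose q))"
  let ?R = "(1 + 2 ^ (2 ^ (k + 1)) * 2 ^ (k + 1) * ?x) * ?mu"
  let ?w = "simplex_weight (p n) :: nat set \<Rightarrow> real"
  have mu: "?mu = real (card (simplex_maps n k)) * W n"
    by (rule expected_ordered_copies_eq[OF p_bounds[OF n(1)] n(1)])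
  have Rnn: "0 \<le> ?R" unfolding mu using W_pos[OF n(1)]
    by (intro mult_nonneg_nonneg add_nonneg_nonneg) auto
  have finL: "finite L" using Suc.prems(1) by (simp add: abstract_complex_def)
  have wnn: "0 \<le> (\<Prod>s\<in>L. ?w s)"
    using p_bounds[OF n(1)] by (intro prod_nonneg) (auto simp: simplex_weight_def)
  have "measure_pmf.expectation (random_complex n (p n))
      (\<lambda>K. indicator {K. L \<subseteq> K} K * real (ordered_copies K (std_simplex k)) ^ Suc l)
    = (\<Sum>f\<in>simplex_maps n k. measure_pmf.expectation (random_complex n (p n))
      (\<lambda>K. indicator {K. L \<union> image_complex k f \<subseteq> K} K * real (ordered_copies K (std_simplex k)) ^ l))"
    by (rule expectation_power_step[OF p_bounds[OF n(1)] n(1)])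
  also have "\<dots> \<le> (\<Sum>f\<in>simplex_maps n k. (\<Prod>s\<in>L \<union> image_complex k f. ?w s) * ?R ^ l)"
  proof (intro sum_mono Suc.IH)
    fix f assume f: "f \<in> simplex_maps n k"
    show "abstract_complex (L \<union> image_complex k f)"
      by (intro abstract_complex_Un Suc.prems(1) abstract_complex_image_complex)
    show "L \<union> image_complex k f \<subseteq> Pow {1..n}"
      using Suc.prems(2) image_complex_subset[OF f] by blast
    fix j assume j: "q \<le> j" "j \<le> k"
    have "{t \<in> L \<union> image_complex k f. card t = j + 1}
        = {t \<in> L. card t = j + 1} \<union> {t \<in> image_complex k f. card t = j + 1}" by blast
    then have "card {t \<in> L \<union> image_complex k f. card t = j + 1}
        \<le> card {t \<in> L. card t = j + 1} + ((k + 1) choose (j + 1))"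
      unfolding card_image_complex[OF f, symmetric] by (simp only: card_Un_le)
    also have "\<dots> \<le> card {t \<in> L. card t = j + 1} + 2 ^ (k + 1)"
      by (intro add_left_mono binomial_le_pow2)
    finally have "real (card {t \<in> L \<union> image_complex k f. card t = j + 1})
        \<le> real (card {t \<in> L. card t = j + 1} + 2 ^ (k + 1))" by (rule of_nat_mono)
    then have "real (card {t \<in> L \<union> image_complex k f. card t = j + 1}) + real l * 2 ^ (k + 1)
        \<le> real (card {t \<in> L. card t = j + 1}) + real (Suc l) * 2 ^ (k + 1)"
      by (simp add: algebra_simps)
    then have "fact (k + 1) * (real (card {t \<in> L \<union> image_complex k f. card t = j + 1}) + real l * 2 ^ (k + 1))
        \<le> fact (k + 1) * (real (card {t \<in> L. card t = j + 1}) + real (Suc l) * 2 ^ (k + 1))"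
      by (rule mult_left_mono) simp
    also have "\<dots> \<le> c * real n powr e" by (rule Suc.prems(3)[OF j])
    finally show "fact (k + 1) * (real (card {t \<in> L \<union> image_complex k f. card t = j + 1}) + real l * 2 ^ (k + 1))
        \<le> c * real n powr e" .
  qed
  also have "\<dots> = (\<Sum>f\<in>simplex_maps n k. \<Prod>s\<in>L \<union> image_complex k f. ?w s) * ?R ^ l"
    by (rule sum_distrib_right[symmetric])
  also have "\<dots> \<le> ((\<Prod>s\<in>L. ?w s) * ?R) * ?R ^ l"
  proof (rule mult_right_mono)
    have "(\<Sum>f\<in>simplex_maps n k. \<Prod>s\<in>L \<union> image_complex k f. ?w s)
        \<le> (\<Prod>s\<in>L. ?w s) * W n * (real (card (simplex_maps n k)) + 2 ^ (2 ^ (k + 1)) * real n ^ (k + 1) * ?x)"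
    proof (rule sum_weight_Un_image_complex_le[OF n(1) c Suc.prems(1)])
      fix j assume j: "q \<le> j" "j \<le> k"
      have "fact (k + 1) * real (card {t \<in> L. card t = j + 1})
          \<le> fact (k + 1) * (real (card {t \<in> L. card t = j + 1}) + real (Suc l) * 2 ^ (k + 1))"
        by (intro mult_left_mono) auto
      also have "\<dots> \<le> c * real n powr e" by (rule Suc.prems(3)[OF j])
      finally show "fact (k + 1) * real (card {t \<in> L. card t = j + 1}) \<le> c * real n powr e" .
    qed
    \<comment> \<open>For \<open>2 * k \<le> n\<close> the power \<open>n ^ (k + 1)\<close> exceeds
      the number of injective maps by a factor of at most \<open>2 ^ (k + 1)\<close>, which makes
      the error a multiple of the expectation.\<close>
    also have "\<dots> \<le> (\<Prod>s\<in>L. ?w s) * W n * (real (card (simplex_maps n k))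
        + 2 ^ (2 ^ (k + 1)) * (2 ^ (k + 1) * real (card (simplex_maps n k))) * ?x)"
      using wnn W_pos[OF n(1)] power_le_card_simplex_maps[OF n(2)]
      by (intro mult_left_mono add_left_mono mult_right_mono mult_nonneg_nonneg) auto
    also have "\<dots> = (\<Prod>s\<in>L. ?w s) * ?R" unfolding mu by (simp only: algebra_simps)
    finally show "(\<Sum>f\<in>simplex_maps n k. \<Prod>s\<in>L \<union> image_complex k f. ?w s) \<le> (\<Prod>s\<in>L. ?w s) * ?R" .
  qed (use Rnn in simp)
  finally show ?case by (simp only: power_Suc mult.assoc)
qed

end

lemma eventually_powr_ge:
  assumes "b > 0"
  shows "\<forall>\<^sub>F n in sequentially. Y \<le> real n powr b"
proof -
  define Y' where "Y' = max Y 1"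
  have "\<forall>\<^sub>F n in sequentially. nat \<lceil>Y' powr (1 / b)\<rceil> \<le> n" by (rule eventually_ge_at_top)
  then show ?thesis
  proof eventually_elim
    case (elim n)
    then have "Y' powr (1 / b) \<le> real n" by linarith
    then have "(Y' powr (1 / b)) powr b \<le> real n powr b"
      using assms by (intro powr_mono2) auto
    then show ?case using assms by (simp add: powr_powr Y'_def)
  qed
qed

section \<open>Counting copies and the extremal parameter\<close>

lemma abstract_complexD:
  assumes "abstract_complex K" "s \<in> K" "t \<subseteq> s" "t \<noteq> {}"
  shows "t \<in> K"
proof -
  have "\<forall>s\<in>K. \<forall>t. t \<subseteq> s \<and> t \<noteq> {} \<longrightarrow> t \<in> K"
    using assms(1) unfolding abstract_complex_def by (elim conjE)
  from this[rule_format, OF assms(2) conjI[OF assms(3,4)]] show ?thesis .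
qed

lemma card_vertices_eq:
  assumes "abstract_complex H"
  shows "num_simplices 0 H = card (\<Union>H)"
proof -
  have "{s \<in> H. card s = 0 + 1} = (\<lambda>v. {v}) ` \<Union>H"
  proof (intro equalityI subsetI)
    fix s assume "s \<in> (\<lambda>v. {v}) ` \<Union>H"
    then obtain v t where "s = {v}" "v \<in> t" "t \<in> H" by blast
    then have "s \<in> H" by (intro abstract_complexD[OF assms \<open>t \<in> H\<close>]) auto
    then show "s \<in> {s \<in> H. card s = 0 + 1}" using \<open>s = {v}\<close> by simp
  qed (auto simp: card_1_singleton_iff)
  then show ?thesis unfolding num_simplices_def by (simp add: card_image)
qed

text \<open>Regrouping by dimension shows that \<open>\<Psi>_H\<close> is a power of
  \<open>n\<close> times the probability that one fixed copy of \<open>H\<close> is present;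
  vertices have weight 1 and enter through the power.\<close>

lemma Psi_eq:
  assumes "abstract_complex H" "\<And>s. s \<in> H \<Longrightarrow> card s \<le> k + 1"
  shows "Psi k p n H = real n ^ card (\<Union>H) * (\<Prod>s\<in>H. simplex_weight p s)"
proof -
  let ?S = "{s \<in> H. 2 \<le> card s}"
  have fin: "finite H" using assms(1) by (simp add: abstract_complex_def)
  have "(\<Prod>s\<in>H. simplex_weight p s) = (\<Prod>s\<in>?S. simplex_weight p s)"
    using fin by (intro prod.mono_neutral_right) (auto simp: simplex_weight_def)
  also have "\<dots> = (\<Prod>i=1..k. \<Prod>s\<in>{s \<in> ?S. card s - 1 = i}. simplex_weight p s)"
  proof (rule prod.group[symmetric])
    show "(\<lambda>s. card s - 1) ` ?S \<subseteq> {1..k}" using assms(2) by fastforce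
  qed (use fin in auto)
  also have "\<dots> = (\<Prod>i=1..k. p i ^ num_simplices i H)"
  proof (rule prod.cong[OF refl])
    fix i assume i: "i \<in> {1..k}"
    then have "{s \<in> ?S. card s - 1 = i} = {s \<in> H. card s = i + 1}" by auto
    then have "(\<Prod>s\<in>{s \<in> ?S. card s - 1 = i}. simplex_weight p s) = (\<Prod>s\<in>{s \<in> H. card s = i + 1}. p i)"
      using i by (intro prod.cong) (auto simp: simplex_weight_def)
    then show "(\<Prod>s\<in>{s \<in> ?S. card s - 1 = i}. simplex_weight p s) = p i ^ num_simplices i H"
      by (simp add: num_simplices_def)
  qed
  finally show ?thesis by (simp add: Psi_def card_vertices_eq[OF assms(1)])
qed

text \<open>Choosing one isomorphism for each copy is injective, because the copy is the image of
  \<open>H\<close>. The set \<open>V\<close> may be larger than the vertex set of \<open>F\<close>,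
  so that its size can be adjusted to \<open>n\<close>.\<close>

lemma unordered_copies_le:
  assumes H: "abstract_complex H" and V: "finite V" "\<Union>F \<subseteq> V"
  shows "unordered_copies F H
    \<le> card {f \<in> \<Union>H \<rightarrow>\<^sub>E V. \<forall>s\<in>H. f ` s \<in> F \<and> card (f ` s) = card s}"
proof -
  let ?C = "{F'. subcomplex F' F \<and> complex_iso H F'}"
  let ?X = "{f \<in> \<Union>H \<rightarrow>\<^sub>E V. \<forall>s\<in>H. f ` s \<in> F \<and> card (f ` s) = card s}"
  have finU: "finite (\<Union>H)" using H by (auto simp: abstract_complex_def)
  have "\<exists>f. f \<in> ?X \<and> (\<lambda>s. f ` s) ` H = F'" if F': "F' \<in> ?C" for F'
  proof -
    obtain f where f: "bij_betw f (\<Union>H) (\<Union>F')" "(\<lambda>s. f ` s) ` H = F'"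
      using F' by (auto simp: complex_iso_def)
    have sub: "F' \<subseteq> F" using F' by (simp add: subcomplex_def)
    let ?g = "restrict f (\<Union>H)"
    have img: "?g ` s = f ` s" if "s \<in> H" for s
      using that by (intro image_cong) auto
    have inj: "inj_on f s" if "s \<in> H" for s
      using f(1) that by (auto simp: bij_betw_def intro: inj_on_subset)
    have "f ` (\<Union>H) \<subseteq> V" using f(1) sub V(2) by (auto simp: bij_betw_def)
    then have "?g \<in> \<Union>H \<rightarrow>\<^sub>E V" by auto
    moreover have "?g ` s \<in> F \<and> card (?g ` s) = card s" if "s \<in> H" for s
      unfolding img[OF that] using inj[OF that] f(2) sub that by (auto simp: card_image)
    moreover have "(\<lambda>s. ?g ` s) ` H = F'"
      using img f(2) by (metis (no_types, lifting) image_cong)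
    ultimately show ?thesis by blast
  qed
  note ex = this
  define \<phi> where "\<phi> F' = (SOME f. f \<in> ?X \<and> (\<lambda>s. f ` s) ` H = F')" for F'
  have \<phi>: "\<phi> F' \<in> ?X \<and> (\<lambda>s. \<phi> F' ` s) ` H = F'" if "F' \<in> ?C" for F'
    unfolding \<phi>_def using ex[OF that] by (rule someI_ex)
  have "inj_on \<phi> ?C"
  proof (rule inj_onI)
    fix F1 F2 assume F: "F1 \<in> ?C" "F2 \<in> ?C" "\<phi> F1 = \<phi> F2"
    have "F1 = (\<lambda>s. \<phi> F1 ` s) ` H" using \<phi>[OF F(1)] by simp
    also have "\<dots> = F2" unfolding F(3) using \<phi>[OF F(2)] by simp
    finally show "F1 = F2" .
  qed
  moreover have "\<phi> ` ?C \<subseteq> ?X" using \<phi> by (intro image_subsetI) blast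
  moreover have "finite ?X"
    using finU V(1) by (intro finite_subset[OF Collect_restrict] finite_PiE)
  ultimately show ?thesis unfolding unordered_copies_def by (rule card_inj_on_le)
qed

text \<open>The uniform bound itself makes the set of values finite and the empty complex makes it
  nonempty, so the \<open>Max\<close> is attained.\<close>

lemma extremal_copies_le:
  assumes "\<And>F :: nat set set. abstract_complex F \<Longrightarrow> (\<And>i. i \<le> k \<Longrightarrow> num_simplices i F \<le> m i)
      \<Longrightarrow> real (unordered_copies F H) \<le> X"
  shows "real (extremal_copies k m H) \<le> X"
proof -
  let ?S = "{unordered_copies F H | F :: nat set set.
      abstract_complex F \<and> (\<forall>i\<le>k. num_simplices i F \<le> m i)}"
  have le: "real v \<le> X" if "v \<in> ?S" for v using that assms by auto
  have "?S \<subseteq> {..nat \<lfloor>X\<rfloor>}"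
  proof
    fix v assume "v \<in> ?S"
    from le[OF this] show "v \<in> {..nat \<lfloor>X\<rfloor>}" by (simp add: le_nat_floor)
  qed
  then have "finite ?S" by (rule finite_subset) simp
  moreover have "unordered_copies ({} :: nat set set) H \<in> ?S"
    by (rule CollectI, rule exI[of _ "{}"]) (simp add: abstract_complex_empty num_simplices_def)
  ultimately have "Max ?S \<in> ?S" by (intro Max_in) auto
  then show ?thesis unfolding extremal_copies_def by (rule le)
qed

text \<open>Here finiteness of the set of values comes from the bound \<open>m 0\<close> on the
  number of vertices.\<close>

lemma extremal_copies_ge:
  assumes H: "abstract_complex H"
    and F: "abstract_complex (F :: nat set set)" "\<And>i. i \<le> k \<Longrightarrow> num_simplices i F \<le> m i"
  shows "unordered_copies F H \<le> extremal_copies k m H"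
proof -
  let ?S = "{unordered_copies F H | F :: nat set set.
      abstract_complex F \<and> (\<forall>i\<le>k. num_simplices i F \<le> m i)}"
  have finU: "finite (\<Union>H)" using H by (auto simp: abstract_complex_def)
  have "v \<le> m 0 ^ card (\<Union>H)" if v: "v \<in> ?S" for v
  proof -
    obtain G :: "nat set set" where G: "v = unordered_copies G H" "abstract_complex G" "num_simplices 0 G \<le> m 0"
      using v by auto
    have finG: "finite (\<Union>G)" using G(2) by (auto simp: abstract_complex_def)
    have "v \<le> card {f \<in> \<Union>H \<rightarrow>\<^sub>E \<Union>G. \<forall>s\<in>H. f ` s \<in> G \<and> card (f ` s) = card s}"
      unfolding G(1) by (rule unordered_copies_le[OF H finG order_refl])
    also have "\<dots> \<le> card (\<Union>H \<rightarrow>\<^sub>E \<Union>G)"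
      using finU finG by (intro card_mono finite_PiE) auto
    also have "\<dots> = num_simplices 0 G ^ card (\<Union>H)"
      using finU by (simp add: card_PiE card_vertices_eq[OF G(2)])
    also have "\<dots> \<le> m 0 ^ card (\<Union>H)" using G(3) by (rule power_mono) simp
    finally show ?thesis .
  qed
  then have "?S \<subseteq> {..m 0 ^ card (\<Union>H)}" by auto
  then have "finite ?S" by (rule finite_subset) simp
  then show ?thesis unfolding extremal_copies_def
    by (rule Max_ge) (use F in blast)
qed

lemma num_simplices_std_simplex: "num_simplices i (std_simplex k) = (k + 1) choose (i + 1)"
  unfolding num_simplices_def by (rule card_std_simplex)

section \<open>Upper tail from above and \<open>M_star\<close> from below\<close>

context clique_exponents
begin

lemma e_pos: "e > 0" using degree of_nat_0_le_iff[of q, where ?'a = real] by linarith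

lemma expected_pos:
  assumes "n \<ge> 1" "k + 1 \<le> n"
  shows "expected_ordered_copies n (p n) (std_simplex k) > 0"
proof -
  have "(\<Prod>i=0..<k+1. n - i) > 0" using assms(2) by (intro prod_pos) auto
  then have "real (card (simplex_maps n k)) > 0" unfolding card_simplex_maps of_nat_0_less_iff .
  then show ?thesis
    unfolding expected_ordered_copies_eq[OF p_bounds[OF assms(1)] assms(1)]
    using W_pos[OF assms(1)] by (rule mult_pos_pos)
qed

lemma upper_tail_le:
  assumes "\<epsilon> > 0"
  shows "\<exists>C>0. \<forall>\<^sub>F n in sequentially.
    measure_pmf.prob (random_complex n (p n))
      {K. real (ordered_copies K (std_simplex k)) \<ge> (1 + \<epsilon>) * expected_ordered_copies n (p n) (std_simplex k)}
    \<le> exp (- (C * real n powr e))"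
proof -
  let ?D = "k choose q"
  define A :: real where "A = 2 ^ (2 ^ (k + 1)) * 2 ^ (k + 1)"
  have A: "A > 0" by (simp add: A_def)
  \<comment> \<open>The sparseness constant for which the relative error
    \<open>A * c powr (1 / ?D)\<close> of each factor in the moment is at most
    \<open>\<epsilon> / 2\<close>.\<close>
  define c where "c = min 1 ((\<epsilon> / (2 * A)) ^ ?D)"
  have c: "0 < c" "c \<le> 1" using assms A by (auto simp: c_def)
  have D: "?D > 0" using q(2) by simp
  have "c powr (1 / ?D) \<le> ((\<epsilon> / (2 * A)) ^ ?D) powr (1 / ?D)"
    using c by (intro powr_mono2) (auto simp: c_def)
  also have "\<dots> = ((\<epsilon> / (2 * A)) powr ?D) powr (1 / ?D)"
    using assms A by (subst powr_realpow) auto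
  also have "\<dots> = \<epsilon> / (2 * A)" unfolding powr_powr using assms A D by simp
  finally have cA: "A * c powr (1 / ?D) \<le> \<epsilon> / 2"
    using A by (simp add: field_simps)
  \<comment> \<open>A union of \<open>l\<close> copies has at most \<open>l * 2 ^ (k + 1)\<close>
    simplices of each size, so moments of order up to \<open>c1 * n powr e\<close> respect
    sparseness with constant \<open>c\<close>.\<close>
  define c1 where "c1 = c / (fact (k + 1) * 2 ^ (k + 1))"
  have c1: "c1 > 0" using c by (simp add: c1_def)
  define r where "r = (1 + \<epsilon> / 2) / (1 + \<epsilon>)"
  have r: "0 < r" "r < 1" using assms by (auto simp: r_def)
  \<comment> \<open>Markov's inequality saves a factor \<open>r\<close> per power; the
    \<open>1 / 2\<close> absorbs the rounding of \<open>l\<close>.\<close>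
  define C where "C = c1 / 2 * (- ln r)"
  have "C > 0" using c1 r by (simp add: C_def mult_pos_neg)
  moreover have "\<forall>\<^sub>F n in sequentially.
    measure_pmf.prob (random_complex n (p n))
      {K. real (ordered_copies K (std_simplex k)) \<ge> (1 + \<epsilon>) * expected_ordered_copies n (p n) (std_simplex k)}
    \<le> exp (- (C * real n powr e))"
  proof (rule eventually_mono[OF eventually_conj[OF eventually_ge_at_top[of "2 * k + 1"] eventually_powr_ge[OF e_pos, of "2 / c1"]]])
    fix n assume "2 * k + 1 \<le> n \<and> 2 / c1 \<le> real n powr e"
    then have n1: "2 * k + 1 \<le> n" and n2: "2 / c1 \<le> real n powr e" by simp_all
    have n: "n \<ge> 1" "2 * k \<le> n" "k + 1 \<le> n" using n1 q by linarith+
    define l where "l = nat \<lfloor>c1 * real n powr e\<rfloor>"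
    have x2: "2 \<le> c1 * real n powr e" using n2 c1 by (simp add: field_simps)
    have l: "real l \<le> c1 * real n powr e" "c1 / 2 * real n powr e \<le> real l"
      unfolding l_def using x2 by linarith+
    let ?N = "\<lambda>K. real (ordered_copies K (std_simplex k))"
    let ?mu = "expected_ordered_copies n (p n) (std_simplex k)"
    let ?M = "random_complex n (p n)"
    let ?t = "(1 + \<epsilon>) * ?mu"
    have mu: "?mu > 0" by (rule expected_pos[OF n(1,3)])
    have t: "?t > 0" using mu assms by simp
    have "measure_pmf.expectation ?M (\<lambda>K. indicator {K. {} \<subseteq> K} K * real (ordered_copies K (std_simplex k)) ^ l)
        \<le> (\<Prod>s\<in>({} :: nat set set). simplex_weight (p n) s) * ((1 + 2 ^ (2 ^ (k + 1)) * 2 ^ (k + 1) * c powr (1 / ?D)) * ?mu) ^ l"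
    proof (rule moment_le[OF n(1,2) less_imp_le[OF c(1)] c(2) abstract_complex_empty])
      fix j
      have "fact (k + 1) * 2 ^ (k + 1) * real l \<le> fact (k + 1) * 2 ^ (k + 1) * (c1 * real n powr e)"
        by (intro mult_left_mono l) auto
      also have "\<dots> = c * real n powr e" by (simp add: c1_def)
      finally show "fact (k + 1) * (real (card {t \<in> {}. card t = j + 1}) + real l * 2 ^ (k + 1)) \<le> c * real n powr e"
        by (simp add: mult_ac)
    qed simp
    then have moment: "measure_pmf.expectation ?M (\<lambda>K. ?N K ^ l) \<le> ((1 + A * c powr (1 / ?D)) * ?mu) ^ l"
      by (simp add: A_def)
    have "?t ^ l * measure_pmf.prob ?M {K. ?N K \<ge> ?t} = measure_pmf.expectation ?M (\<lambda>K. ?t ^ l * indicator {K. ?N K \<ge> ?t} K)"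
      by simp
    also have "\<dots> \<le> measure_pmf.expectation ?M (\<lambda>K. ?N K ^ l)"
    proof (rule integral_mono[OF integrable_random_complex integrable_random_complex])
      fix K
      show "?t ^ l * indicator {K. ?N K \<ge> ?t} K \<le> ?N K ^ l"
        using t by (auto simp: indicator_def intro!: power_mono)
    qed
    also have "\<dots> \<le> ((1 + A * c powr (1 / ?D)) * ?mu) ^ l" by (rule moment)
    also have "\<dots> \<le> ((1 + \<epsilon> / 2) * ?mu) ^ l"
      using cA mu A c by (intro power_mono mult_right_mono) auto
    also have "(1 + \<epsilon> / 2) * ?mu = r * ?t" using assms by (simp add: r_def)
    also have "(r * ?t) ^ l = ?t ^ l * r ^ l" by (simp add: power_mult_distrib)
    finally have "measure_pmf.prob ?M {K. ?N K \<ge> ?t} \<le> r ^ l"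
      using t by (simp add: mult_le_cancel_left_pos)
    also have "r ^ l = exp (real l * ln r)"
      using r(1) by (simp add: exp_of_nat_mult)
    also have "\<dots> \<le> exp (- (C * real n powr e))"
    proof -
      have "c1 / 2 * real n powr e * (- ln r) \<le> real l * (- ln r)"
        using l(2) r by (intro mult_right_mono) auto
      then show ?thesis by (simp add: C_def mult_ac)
    qed
    finally show "measure_pmf.prob ?M {K. ?N K \<ge> ?t} \<le> exp (- (C * real n powr e))" .
  qed
  ultimately show ?thesis by blast
qed

text \<open>This is the set under the \<open>Max\<close> in \<open>M_star\<close>. A lower bound
  needs finiteness and one element; an upper bound needs the maximum to be attained, which is why
  nonemptiness is recorded together with the lower bound.\<close>

abbreviation "admissible n \<equiv> {m. 1 \<le> m \<and> real m \<le> real (n choose (k + 1)) / real (num_simplices k (std_simplex k)) \<and>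
   (\<forall>H. subcomplex H (std_simplex k) \<and> H \<noteq> {} \<longrightarrow>
      real (extremal_copies k (\<lambda>i. if i = 0 then n else m * num_simplices i (std_simplex k)) H) \<le> Psi k (p n) n H)}"

lemma finite_admissible: "finite (admissible n)"
proof (rule finite_subset)
  show "admissible n \<subseteq> {..n choose (k + 1)}"
  proof
    fix m assume "m \<in> admissible n"
    then have "real m \<le> real (n choose (k + 1)) / real (num_simplices k (std_simplex k))" by blast
    then show "m \<in> {..n choose (k + 1)}" unfolding num_simplices_std_simplex by simp
  qed
qed simp

text \<open>The defining condition of \<open>M_star\<close> compares with \<open>\<Psi>_H\<close>
  without any constant, and the sparse count with \<open>c = 1\<close> delivers exactly that. The
  factorial and the bound \<open>2 ^ (k + 1)\<close> on the face numbers are absorbed by the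
  condition on \<open>m\<close>.\<close>

lemma admissibleI:
  assumes n: "n \<ge> 1" and m: "1 \<le> m" "m \<le> n choose (k + 1)" "fact (k + 1) * (real m * 2 ^ (k + 1)) \<le> real n powr e"
  shows "m \<in> admissible n"
proof -
  have "real (extremal_copies k (\<lambda>i. if i = 0 then n else m * num_simplices i (std_simplex k)) H) \<le> Psi k (p n) n H"
    if H: "subcomplex H (std_simplex k)" for H
  proof (rule extremal_copies_le)
    fix F :: "nat set set"
    assume F: "abstract_complex F"
      and bound: "\<And>i. i \<le> k \<Longrightarrow> num_simplices i F \<le> (if i = 0 then n else m * num_simplices i (std_simplex k))"
    have cH: "abstract_complex H" "H \<subseteq> std_simplex k" using H by (auto simp: subcomplex_def)
    have UH: "\<Union>H \<subseteq> {0..k}" using cH(2) by (auto simp: std_simplex_def)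
    have finUH: "finite (\<Union>H)" by (rule finite_subset[OF UH]) simp
    have cardH: "card s \<le> k + 1" if "s \<in> H" for s
      using that cH(2) card_std_simplex_le by blast
    have finF: "finite F" and finUF: "finite (\<Union>F)" using F by (auto simp: abstract_complex_def)
    have cardUF: "card (\<Union>F) \<le> n" using bound[of 0] card_vertices_eq[OF F] by simp
    \<comment> \<open>The complex \<open>F\<close> may have fewer than \<open>n\<close> vertices,
      whereas the count is stated for \<open>card V = n\<close>; the missing points are
      padded.\<close>
    obtain T where T: "T \<subseteq> - \<Union>F" "finite T" "card T = n - card (\<Union>F)"
      using infinite_arbitrarily_large[of "- \<Union>F" "n - card (\<Union>F)"] finUF
      by (auto simp: Compl_eq_Diff_UNIV)
    define V where "V = \<Union>F \<union> T"
    have V: "finite V" "card V = n" "\<Union>F \<subseteq> V"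
    proof -
      have "card V = card (\<Union>F) + card T"
        unfolding V_def using T finUF by (intro card_Un_disjoint) auto
      then show "card V = n" using T(3) cardUF by simp
    qed (use T(2) finUF in \<open>auto simp: V_def\<close>)
    have le: "real (unordered_copies F H) \<le> real (card {f \<in> \<Union>H \<rightarrow>\<^sub>E V. \<forall>s\<in>H. f ` s \<in> F \<and> card (f ` s) = card s})"
      using unordered_copies_le[OF cH(1) V(1,3)] by simp
    have "real (unordered_copies F H) \<le> real n ^ card (\<Union>H) * (\<Prod>s\<in>H. simplex_weight (p n) s)"
    proof (cases "\<exists>s1\<in>H. q < card s1")
      case True
      then obtain s1 where s1: "s1 \<in> H" "q < card s1" by blast
      have "real (card {f \<in> \<Union>H \<rightarrow>\<^sub>E V. \<forall>s\<in>H. f ` s \<in> F \<and> card (f ` s) = card s})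
          \<le> real n ^ card (\<Union>H) * 1 powr (1 / (k choose q)) * (\<Prod>s\<in>H. simplex_weight (p n) s)"
      proof (rule card_maps_into_sparse_le[OF UH V(1,2) n finF _ s1])
        fix j assume j: "q \<le> j" "j \<le> k"
        \<comment> \<open>As \<open>j \<ge> q \<ge> 1\<close>, the restriction in force is the one
          with \<open>m\<close> and not the one on vertices.\<close>
        have "card {t \<in> F. card t = j + 1} \<le> m * ((k + 1) choose (j + 1))"
          using bound[OF j(2)] j q unfolding num_simplices_std_simplex
          by (simp add: num_simplices_def split: if_splits)
        also have "\<dots> \<le> m * 2 ^ (k + 1)" by (intro mult_left_mono binomial_le_pow2) simp
        finally have "real (card {t \<in> F. card t = j + 1}) \<le> real (m * 2 ^ (k + 1))"
          by (rule of_nat_mono)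
        then have "fact (k + 1) * real (card {t \<in> F. card t = j + 1}) \<le> fact (k + 1) * (real m * 2 ^ (k + 1))"
          by (intro mult_left_mono) auto
        also note m(3)
        finally show "fact (k + 1) * real (card {t \<in> F. card t = j + 1}) \<le> 1 * real n powr e" by simp
      qed auto
      then show ?thesis using le by simp
    next
      case False
      \<comment> \<open>If \<open>H\<close> has dimension below \<open>q\<close>, all weights are 1
        and the trivial count of maps suffices.\<close>
      have "(\<Prod>s\<in>H. simplex_weight (p n) s) = 1"
        using False n cardH by (intro prod.neutral) (auto simp: simplex_weight_eq)
      moreover have "real (card {f \<in> \<Union>H \<rightarrow>\<^sub>E V. \<forall>s\<in>H. f ` s \<in> F \<and> card (f ` s) = card s})
          \<le> real (card (\<Union>H \<rightarrow>\<^sub>E V))"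
        using finUH V(1) by (intro of_nat_mono card_mono finite_PiE) auto
      moreover have "card (\<Union>H \<rightarrow>\<^sub>E V) = n ^ card (\<Union>H)"
        using finUH V(2) by (simp add: card_PiE)
      ultimately show ?thesis using le by simp
    qed
    then show "real (unordered_copies F H) \<le> Psi k (p n) n H"
      by (simp add: Psi_eq[OF cH(1) cardH])
  qed
  then show ?thesis using m(1,2) by (simp add: num_simplices_std_simplex)
qed

lemma M_star_ge:
  "\<exists>C\<ge>1. \<forall>\<^sub>F n in sequentially. admissible n \<noteq> {} \<and> inverse C * real n powr e \<le> real (M_star k (p n) n (std_simplex k))"
proof -
  define A :: real where "A = fact (k + 1) * 2 ^ (k + 1)"
  have "1 * 1 \<le> A" unfolding A_def by (intro mult_mono fact_ge_1 one_le_power) auto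
  then have A: "A \<ge> 1" by simp
  have "\<forall>\<^sub>F n in sequentially. admissible n \<noteq> {} \<and> inverse (2 * A) * real n powr e \<le> real (M_star k (p n) n (std_simplex k))"
  proof (rule eventually_mono[OF eventually_conj[OF eventually_ge_at_top[of "k + 1"]
        eventually_conj[OF eventually_powr_ge[OF e_pos, of "2 * A"]
          eventually_powr_ge[OF B_pos, of "real (k + 1) ^ (k + 1)"]]]])
    fix n assume "k + 1 \<le> n \<and> 2 * A \<le> real n powr e \<and> real (k + 1) ^ (k + 1) \<le> real n powr B"
    then have n1: "k + 1 \<le> n" and n2: "2 * A \<le> real n powr e"
      and n3: "real (k + 1) ^ (k + 1) \<le> real n powr B" by simp_all
    have n: "n \<ge> 1" using n1 by simp
    define x where "x = real n powr e / A"
    define m where "m = nat \<lfloor>x\<rfloor>"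
    have "2 \<le> x" using n2 A by (simp add: x_def field_simps)
    then have m: "1 \<le> m" "real m \<le> real n powr e / A" "x / 2 \<le> real m"
      unfolding x_def[symmetric] m_def by linarith+
    \<comment> \<open>The chain verifies \<open>m \<le> n choose (k + 1)\<close>. Even for
      \<open>q = k\<close> the exponent \<open>e\<close> stays below \<open>k + 1\<close> by
      \<open>B > 0\<close>, which beats the constant \<open>(k + 1) ^ (k + 1)\<close> lost in the
      lower bound for the binomial coefficient.\<close>
    have "real m \<le> real n powr e / A" by (rule m(2))
    also have "\<dots> \<le> real n powr e / 1" using A by (intro divide_left_mono) auto
    also have "\<dots> \<le> real n powr (real (k + 1) - B)"
      unfolding div_by_1 using n q(2) by (intro powr_mono) auto
    also have "\<dots> = real n ^ (k + 1) / real n powr B"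
      unfolding powr_diff using n by (subst powr_realpow) simp_all
    also have "\<dots> \<le> real n ^ (k + 1) / real (k + 1) ^ (k + 1)"
      using n3 n by (intro divide_left_mono mult_pos_pos) auto
    also have "\<dots> = (real n / real (k + 1)) ^ (k + 1)" by (simp only: power_divide)
    also have "\<dots> \<le> real (n choose (k + 1))"
      by (rule binomial_ge_n_over_k_pow_k[OF n1])
    finally have mn: "m \<le> n choose (k + 1)" by simp
    have "A * real m \<le> real n powr e" using m(2) A by (simp add: field_simps)
    then have m3: "fact (k + 1) * (real m * 2 ^ (k + 1)) \<le> real n powr e"
      by (simp add: A_def mult_ac)
    have "m \<in> admissible n" by (rule admissibleI[OF n m(1) mn m3])
    then have "m \<le> M_star k (p n) n (std_simplex k)"
      unfolding M_star_def by (intro Max_ge finite_admissible)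
    then have "x / 2 \<le> real (M_star k (p n) n (std_simplex k))" using m(3) by linarith
    moreover have "inverse (2 * A) * real n powr e = x / 2" by (simp add: x_def field_simps)
    ultimately show "admissible n \<noteq> {} \<and> inverse (2 * A) * real n powr e \<le> real (M_star k (p n) n (std_simplex k))"
      using \<open>m \<in> admissible n\<close> by (intro conjI) (blast, simp only:)
  qed
  then show ?thesis using A by (intro exI[of _ "2 * A"]) auto
qed

end

section \<open>Planting centres\<close>

text \<open>With \<open>X = {0..k}\<close> and \<open>A = {0}\<close> this is the star of a vertex
  in the \<open>q\<close>-skeleton, completed by the whole \<open>(q - 1)\<close>-skeleton; with
  \<open>X = {1..n}\<close> and \<open>A\<close> the set of centres it is the planted complex.
  Including all sets of size at most \<open>q\<close> makes it closed under faces.\<close>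

definition star_complex :: "'a set \<Rightarrow> 'a set \<Rightarrow> nat \<Rightarrow> 'a set set" where
  "star_complex X A q = {s. s \<subseteq> X \<and> s \<noteq> {} \<and> (card s \<le> q \<or> card s = q + 1 \<and> s \<inter> A \<noteq> {})}"

lemma abstract_complex_star:
  assumes "finite X"
  shows "abstract_complex (star_complex X A q)"
proof -
  have "finite (star_complex X A q)"
    by (rule finite_subset[of _ "Pow X"]) (use assms in \<open>auto simp: star_complex_def\<close>)
  moreover have "finite s \<and> s \<noteq> {}" if "s \<in> star_complex X A q" for s
    using that assms by (auto simp: star_complex_def intro: finite_subset)
  moreover have "t \<in> star_complex X A q"
    if s: "s \<in> star_complex X A q" and t: "t \<subseteq> s" "t \<noteq> {}" for s t
  proof (cases "t = s")
    case False
    then have "t \<subset> s" using t by blast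
    moreover have "finite s" using s assms by (auto simp: star_complex_def intro: finite_subset)
    ultimately have "card t < card s" by (intro psubset_card_mono)
    then show ?thesis using s t by (auto simp: star_complex_def)
  qed (use s in simp)
  ultimately show ?thesis unfolding abstract_complex_def by simp
qed

lemma Union_star_complex: "1 \<le> q \<Longrightarrow> \<Union>(star_complex X A q) = X"
proof (intro equalityI subsetI)
  fix x assume "1 \<le> q" "x \<in> X"
  then have "{x} \<in> star_complex X A q" by (simp add: star_complex_def)
  then show "x \<in> \<Union>(star_complex X A q)" by blast
qed (auto simp: star_complex_def)

lemma image_star_complex:
  assumes "inj_on f X" "A \<subseteq> X"
  shows "(\<lambda>s. f ` s) ` star_complex X A q = star_complex (f ` X) (f ` A) q"
proof (intro equalityI subsetI)
  fix t assume "t \<in> (\<lambda>s. f ` s) ` star_complex X A q"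
  then obtain s where s: "s \<in> star_complex X A q" "t = f ` s" by blast
  then have "card t = card s" using assms(1)
    by (auto simp: star_complex_def intro!: card_image intro: inj_on_subset)
  then show "t \<in> star_complex (f ` X) (f ` A) q"
    using s by (auto simp: star_complex_def)
next
  fix t assume t: "t \<in> star_complex (f ` X) (f ` A) q"
  then obtain s where s: "s \<subseteq> X" "t = f ` s" by (auto simp: star_complex_def subset_image_iff)
  have "card t = card s" unfolding s(2) using assms(1) s(1) by (intro card_image) (rule inj_on_subset)
  moreover have "s \<inter> A \<noteq> {}" if "f ` s \<inter> f ` A \<noteq> {}"
    using that inj_on_image_Int[OF assms(1) s(1) assms(2)] by auto
  moreover have "t \<noteq> {}" "card t \<le> q \<or> card t = q + 1 \<and> f ` s \<inter> f ` A \<noteq> {}"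
    using t s(2) by (simp_all add: star_complex_def)
  ultimately have "s \<in> star_complex X A q"
    using s(1) unfolding star_complex_def s(2) by (intro CollectI conjI) auto
  then show "t \<in> (\<lambda>s. f ` s) ` star_complex X A q" using s(2) by blast
qed

lemma complex_iso_star:
  assumes S: "finite S" "card S = k" "v \<notin> S" and q: "1 \<le> q"
  shows "complex_iso (star_complex {0..k} {0} q) (star_complex (insert v S) {v} q)"
proof -
  have "card {1..k} = card S" using S(2) by simp
  then obtain g where g: "bij_betw g {1..k} S"
    using finite_same_card_bij[OF _ S(1)] by blast
  define f where "f = g(0 := v)"
  have "bij_betw f {1..k} S"
    using g by (subst bij_betw_cong[of _ _ g]) (auto simp: f_def)
  moreover have "bij_betw f {0} {v}" by (simp add: f_def bij_betw_def)
  ultimately have "bij_betw f ({0} \<union> {1..k}) ({v} \<union> S)"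
    using S(3) by (intro bij_betw_combine) auto
  moreover have "{0} \<union> {1..k} = {0..k}" by auto
  ultimately have bij: "bij_betw f {0..k} (insert v S)" by simp
  then have "(\<lambda>s. f ` s) ` star_complex {0..k} {0} q = star_complex (f ` {0..k}) (f ` {0}) q"
    by (intro image_star_complex) (auto simp: bij_betw_def)
  also have "\<dots> = star_complex (insert v S) {v} q"
    using bij by (simp add: bij_betw_def f_def)
  finally show ?thesis
    unfolding complex_iso_def Union_star_complex[OF q] using bij by blast
qed

text \<open>Each centre \<open>v\<close> and each \<open>k\<close>-set of non-centres span a copy.
  Keeping the other vertices away from \<open>{1..a}\<close> makes \<open>v\<close> recoverable from
  the vertex set of the copy, so these copies are distinct.\<close>

lemma unordered_copies_star_ge:
  assumes q: "1 \<le> q" and a: "a \<le> n"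
  shows "a * ((n - a) choose k)
    \<le> unordered_copies (star_complex {1..n} {1..a} q) (star_complex {0..k} {0::nat} q)"
proof -
  let ?P = "{1..a} \<times> {S. S \<subseteq> {a+1..n} \<and> card S = k}"
  let ?c = "\<lambda>(v, S). star_complex (insert v S) {v :: nat} q"
  let ?C = "{F'. subcomplex F' (star_complex {1..n} {1..a} q) \<and> complex_iso (star_complex {0..k} {0::nat} q) F'}"
  have inj: "inj_on ?c ?P"
  proof (rule inj_onI)
    fix x y assume x: "x \<in> ?P" and y: "y \<in> ?P" and xy: "?c x = ?c y"
    obtain v S where xS: "x = (v, S)" by (cases x)
    obtain v' S' where yS: "y = (v', S')" by (cases y)
    have v: "1 \<le> v" "v \<le> a" and S: "S \<subseteq> {Suc a..n}" using x unfolding xS by auto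
    have v': "1 \<le> v'" "v' \<le> a" and S': "S' \<subseteq> {Suc a..n}" using y unfolding yS by auto
    have eq: "star_complex (insert v S) {v} q = star_complex (insert v' S') {v'} q"
      using xy unfolding xS yS by simp
    have U: "insert v S = insert v' S'"
      using arg_cong[OF eq, of Union] by (simp only: Union_star_complex[OF q])
    have "insert v S \<inter> {1..a} = {v}" "insert v' S' \<inter> {1..a} = {v'}"
      using v v' S S' by auto
    then have vv: "v = v'" using U by simp
    have "v \<notin> S" "v' \<notin> S'" using v v' S S' by auto
    then have "S = S'" using U vv by (simp add: insert_ident)
    then show "x = y" using vv xS yS by simp
  qed
  have sub: "?c ` ?P \<subseteq> ?C"
  proof (rule image_subsetI)
    fix x assume "x \<in> ?P"
    then obtain v S where x: "x = (v, S)" "v \<in> {1..a}" "S \<subseteq> {a+1..n}" "card S = k" by auto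
    have "finite S" by (rule finite_subset[OF x(3)]) simp
    moreover have "v \<notin> S" using x(2,3) by auto
    ultimately have "complex_iso (star_complex {0..k} {0} q) (star_complex (insert v S) {v} q)"
      using x(4) q by (intro complex_iso_star)
    moreover have "insert v S \<subseteq> {1..n}" using x(2,3) a by auto
    then have "star_complex (insert v S) {v} q \<subseteq> star_complex {1..n} {1..a} q"
      using x(2) by (auto simp: star_complex_def)
    ultimately show "?c x \<in> ?C"
      using \<open>finite S\<close> unfolding x(1) by (simp add: subcomplex_def abstract_complex_star)
  qed
  have "finite (star_complex {1..n} {1..a} q)"
    using abstract_complex_star[of "{1..n}"] by (simp add: abstract_complex_def)
  then have fin: "finite ?C"
    by (intro finite_subset[of ?C "Pow (star_complex {1..n} {1..a} q)"]) (auto simp: subcomplex_def)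
  have "a * ((n - a) choose k) = card ?P"
    by (simp add: card_cartesian_product n_subsets)
  also have "\<dots> \<le> card ?C" by (rule card_inj_on_le[OF inj sub fin])
  finally show ?thesis unfolding unordered_copies_def .
qed

lemma card_star_top_le:
  "card {s \<in> star_complex {1..n} {1..a} q. card s = q + 1} \<le> a * n ^ q"
proof (cases "n = 0")
  case True
  then have "{s \<in> star_complex {1..n} {1..a} q. card s = q + 1} = {}"
    by (auto simp: star_complex_def)
  then show ?thesis by (simp only: card.empty)
next
  case False
  let ?T = "\<lambda>v. {s. s \<subseteq> {1..n} \<and> v \<in> s \<and> card s = Suc q}"
  have "card {s \<in> star_complex {1..n} {1..a} q. card s = q + 1} \<le> card (\<Union>v\<in>{1..a}. ?T v)"
  proof (rule card_mono)
    show "finite (\<Union>v\<in>{1..a}. ?T v)"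
      by (rule finite_subset[of _ "Pow {1..n}"]) auto
  qed (auto simp: star_complex_def)
  also have "\<dots> \<le> (\<Sum>v\<in>{1..a}. card (?T v))" by (rule card_UN_le) simp
  also have "\<dots> \<le> (\<Sum>v\<in>{1..a}. n ^ q)"
  proof (rule sum_mono)
    fix v
    show "card (?T v) \<le> n ^ q"
    proof (cases "v \<in> {1..n}")
      case True
      then have "card (?T v) = (n - 1) choose q" by (subst card_subsets_containing) auto
      also have "\<dots> \<le> n ^ q"
      proof (cases "q \<le> n - 1")
        case True
        then have "(n - 1) choose q \<le> (n - 1) ^ q" by (rule binomial_le_pow)
        also have "\<dots> \<le> n ^ q" by (intro power_mono) auto
        finally show ?thesis .
      qed (simp add: binomial_eq_0)
      finally show ?thesis .
    next
      case False
      then have "?T v = {}" by auto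
      then show ?thesis by (simp only: card.empty)
    qed
  qed
  finally show ?thesis by simp
qed

text \<open>This is the source of the extra summand \<open>n ^ q\<close> in the upper bound for
  admissible \<open>m\<close>; it is of lower order than \<open>n powr e\<close> because
  \<open>B < 1\<close>.\<close>

lemma num_simplices_star_le:
  assumes "1 \<le> i" "i < q" "n \<ge> 1"
  shows "num_simplices i (star_complex {1..n} {1..a} q) \<le> n ^ q"
proof -
  have "num_simplices i (star_complex {1..n} {1..a} q) \<le> card {s. s \<subseteq> {1..n} \<and> card s = i + 1}"
    unfolding num_simplices_def
    by (intro card_mono finite_subset[of "{s. s \<subseteq> {1..n} \<and> card s = i + 1}" "Pow {1..n}"])
      (auto simp: star_complex_def)
  also have "\<dots> = n choose (i + 1)" by (simp add: n_subsets)
  also have "\<dots> \<le> n ^ (i + 1)"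
  proof (cases "i + 1 \<le> n")
    case True
    then show ?thesis by (rule binomial_le_pow)
  qed (simp add: binomial_eq_0)
  also have "\<dots> \<le> n ^ q" using assms by (intro power_increasing) auto
  finally show ?thesis .
qed

text \<open>The value at 0 of an injective map is equidistributed over \<open>{1..n}\<close>. For
  the lower bound, maps are assembled from a first value \<open>v\<close> and an injection of the
  other \<open>k\<close> points into the remaining ones.\<close>

lemma card_simplex_maps_starting:
  assumes "a \<le> n" "n \<ge> 1"
  shows "real (card (simplex_maps n k)) * real a
    \<le> real n * real (card {f \<in> simplex_maps n k. f 0 \<in> {1..a}})"
proof -
  let ?G = "SIGMA v : {1..a}. {g \<in> {1..k} \<rightarrow>\<^sub>E {1..n} - {v}. inj_on g {1..k}}"
  let ?h = "\<lambda>(v, g). g(0 := v) :: nat \<Rightarrow> nat"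
  have ins: "{0..k} = insert 0 {1..k}" by auto
  have "inj_on ?h ?G"
  proof (rule inj_onI)
    fix x y assume "x \<in> ?G" "y \<in> ?G" and eq: "?h x = ?h y"
    then obtain v g v' g' where x: "x = (v, g)" "g \<in> {1..k} \<rightarrow>\<^sub>E {1..n} - {v}"
      and y: "y = (v', g')" "g' \<in> {1..k} \<rightarrow>\<^sub>E {1..n} - {v'}" by auto
    have e: "g(0 := v) = g'(0 := v')" using eq x(1) y(1) by simp
    have "g j = g' j" for j
    proof (cases "j = 0")
      case True
      then show ?thesis using x(2) y(2) by (simp add: PiE_def extensional_def)
    next
      case False
      then show ?thesis using fun_cong[OF e, of j] by simp
    qed
    moreover have "v = v'" using fun_cong[OF e, of 0] by simp
    ultimately show "x = y" unfolding x(1) y(1) by auto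
  qed
  moreover have "?h ` ?G \<subseteq> {f \<in> simplex_maps n k. f 0 \<in> {1..a}}"
  proof (rule image_subsetI)
    fix x assume "x \<in> ?G"
    then obtain v g where x: "x = (v, g)" "v \<in> {1..a}" "g \<in> {1..k} \<rightarrow>\<^sub>E {1..n} - {v}" "inj_on g {1..k}"
      by auto
    have "g(0 := v) \<in> {0..k} \<rightarrow>\<^sub>E {1..n}"
      using x(2,3) assms(1) by (auto simp: PiE_iff extensional_def)
    moreover have "inj_on (g(0 := v)) {0..k}"
    proof -
      have "inj_on (g(0 := v)) {1..k}"
        by (subst inj_on_cong[of _ _ g]) (use x(4) in auto)
      moreover have "v \<notin> g ` {1..k}" using x(3) by (auto simp: PiE_iff)
      moreover have "(g(0 := v)) ` ({1..k} - {0}) = g ` {1..k}"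
        by (intro image_cong) auto
      ultimately show ?thesis unfolding ins by (simp add: inj_on_insert)
    qed
    ultimately show "?h x \<in> {f \<in> simplex_maps n k. f 0 \<in> {1..a}}"
      using x(1,2) by (simp add: simplex_maps_def)
  qed
  moreover have "finite {f \<in> simplex_maps n k. f 0 \<in> {1..a}}"
    using finite_simplex_maps by simp
  ultimately have "card ?G \<le> card {f \<in> simplex_maps n k. f 0 \<in> {1..a}}" by (rule card_inj_on_le)
  moreover have "card ?G = a * (\<Prod>i=0..<k. n - Suc i)"
  proof -
    have "card {g \<in> {1..k} \<rightarrow>\<^sub>E {1..n} - {v}. inj_on g {1..k}} = (\<Prod>i=0..<k. n - Suc i)"
      if "v \<in> {1..a}" for v
      using that assms(1) by (subst card_inj_on_subset_funcset) auto
    moreover have "finite {g \<in> {1..k} \<rightarrow>\<^sub>E {1..n} - {v}. inj_on g {1..k}}" for v :: nat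
      by (rule finite_subset[OF Collect_restrict]) (auto intro: finite_PiE)
    ultimately show ?thesis by simp
  qed
  moreover have "card (simplex_maps n k) = n * (\<Prod>i=0..<k. n - Suc i)"
    unfolding card_simplex_maps by (simp add: prod.atLeast0_lessThan_Suc_shift del: prod.op_ivl_Suc)
  ultimately have "card (simplex_maps n k) * a \<le> n * card {f \<in> simplex_maps n k. f 0 \<in> {1..a}}"
    by (simp add: mult.commute)
  then have "real (card (simplex_maps n k) * a) \<le> real (n * card {f \<in> simplex_maps n k. f 0 \<in> {1..a}})"
    by (rule of_nat_mono)
  then show ?thesis by simp
qed

section \<open>\<open>M_star\<close> from above and upper tail from below\<close>

context clique_exponents
begin

lemma card_star_le: "s \<in> star_complex X A q \<Longrightarrow> card s \<le> k + 1"
  using q(2) by (auto simp: star_complex_def)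

lemma prod_weight_star:
  assumes "n \<ge> 1" "finite X"
  shows "(\<Prod>s\<in>star_complex X A q. simplex_weight (p n) s)
    = real n powr - (real (card {s \<in> star_complex X A q. card s = q + 1}) * a q)"
proof -
  have "finite (star_complex X A q)"
    using abstract_complex_star[OF assms(2)] by (simp add: abstract_complex_def)
  then have "(\<Prod>s\<in>star_complex X A q. simplex_weight (p n) s)
      = real n powr - (\<Sum>s\<in>{s\<in>star_complex X A q. q < card s}. a (card s - 1))"
    by (rule prod_weight_eq[OF assms(1) _ card_star_le])
  also have "{s\<in>star_complex X A q. q < card s} = {s \<in> star_complex X A q. card s = q + 1}"
    by (auto simp: star_complex_def)
  also have "(\<Sum>s\<in>\<dots>. a (card s - 1)) = real (card {s \<in> star_complex X A q. card s = q + 1}) * a q"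
    by simp
  finally show ?thesis .
qed

text \<open>All \<open>q\<close>-simplices of this complex contain the vertex 0, and there are
  \<open>k choose q\<close> of them; this is the origin of \<open>B\<close>.\<close>

lemma Psi_star:
  assumes "n \<ge> 1"
  shows "Psi k (p n) n (star_complex {0..k} {0::nat} q) = real n ^ (k + 1) * real n powr - B"
proof -
  have "{s \<in> star_complex {0..k} {0::nat} q. card s = q + 1} = {s. s \<subseteq> {0..k} \<and> 0 \<in> s \<and> card s = Suc q}"
    by (auto simp: star_complex_def)
  then have "card {s \<in> star_complex {0..k} {0::nat} q. card s = q + 1} = k choose q"
    by (simp add: card_subsets_containing)
  moreover have "Psi k (p n) n (star_complex {0..k} {0::nat} q)
      = real n ^ card (\<Union>(star_complex {0..k} {0::nat} q)) * (\<Prod>s\<in>star_complex {0..k} {0::nat} q. simplex_weight (p n) s)"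
    by (rule Psi_eq[OF abstract_complex_star[OF finite_atLeastAtMost] card_star_le])
  ultimately show ?thesis
    unfolding Union_star_complex[OF q(1)] prod_weight_star[OF assms finite_atLeastAtMost] by simp
qed

text \<open>Because \<open>B < 1\<close>, the number of centres is large enough for rounding to cost
  at most a factor 2; because \<open>B > 0\<close>, it stays below \<open>n / 2\<close>.\<close>

lemma eventually_centres:
  assumes "C0 \<ge> 2"
  shows "\<forall>\<^sub>F n in sequentially. 2 * k + 1 \<le> n \<and> 2 * real (nat \<lfloor>C0 * real n powr (1 - B)\<rfloor>) \<le> real n
    \<and> C0 / 2 * real n powr (1 - B) \<le> real (nat \<lfloor>C0 * real n powr (1 - B)\<rfloor>)"
proof -
  have "1 - B > 0" using degree by linarith
  show ?thesis
  proof (rule eventually_mono[OF eventually_conj[OF eventually_ge_at_top[of "2 * k + 1"]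
        eventually_conj[OF eventually_powr_ge[OF \<open>1 - B > 0\<close>, of 1] eventually_powr_ge[OF B_pos, of "2 * C0"]]]])
    fix n assume "2 * k + 1 \<le> n \<and> 1 \<le> real n powr (1 - B) \<and> 2 * C0 \<le> real n powr B"
    then have n: "2 * k + 1 \<le> n" "1 \<le> real n powr (1 - B)" "2 * C0 \<le> real n powr B" by simp_all
    define x where "x = C0 * real n powr (1 - B)"
    have "2 * 1 \<le> x" unfolding x_def using assms n(2) by (intro mult_mono) auto
    then have x: "real (nat \<lfloor>x\<rfloor>) \<le> x" "x / 2 \<le> real (nat \<lfloor>x\<rfloor>)" by linarith+
    have "2 * x = (2 * C0) * real n powr (1 - B)" by (simp add: x_def)
    also have "\<dots> \<le> real n powr B * real n powr (1 - B)"
      using n(3) by (rule mult_right_mono) simp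
    also have "\<dots> = real n" using n(1) unfolding powr_add[symmetric] by simp
    finally show "2 * k + 1 \<le> n \<and> 2 * real (nat \<lfloor>C0 * real n powr (1 - B)\<rfloor>) \<le> real n
        \<and> C0 / 2 * real n powr (1 - B) \<le> real (nat \<lfloor>C0 * real n powr (1 - B)\<rfloor>)"
      using x n(1) unfolding x_def[symmetric] by (simp add: x_def)
  qed
qed

lemma powr_e_eq: "n \<ge> 1 \<Longrightarrow> real n powr e = real n powr (1 - B) * real n ^ q"
  by (simp add: powr_realpow[symmetric] powr_add[symmetric] algebra_simps)

text \<open>For larger \<open>m\<close> the planted complex would obey all restrictions on the
  numbers of simplices, but its copies of the star of a vertex outnumber \<open>\<Psi>\<close> of
  that star.\<close>

lemma admissible_le:
  assumes m: "m \<in> admissible n" and n: "2 * k + 1 \<le> n" and a2: "2 * real h \<le> real n"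
    and C0: "C0 \<ge> 4 * (2 * real k) ^ k" and ge: "C0 / 2 * real n powr (1 - B) \<le> real h"
  shows "real m \<le> real h * real n ^ q + real n ^ q"
proof (rule ccontr)
  assume "\<not> ?thesis"
  then have "real (h * n ^ q + n ^ q) < real m" by simp
  then have mn: "h * n ^ q + n ^ q < m" unfolding of_nat_less_iff .
  let ?F = "star_complex {1..n} {1..h} q"
  let ?H = "star_complex {0..k} {0::nat} q"
  have n1: "n \<ge> 1" and an: "h \<le> n" using n a2 by linarith+
  have sub: "subcomplex ?H (std_simplex k)"
    unfolding subcomplex_def using abstract_complex_star[of "{0..k}" "{0}" q]
    by (auto simp: star_complex_def std_simplex_def)
  have ne: "?H \<noteq> {}" using Union_star_complex[OF q(1), of "{0..k}" "{0}"] by auto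
  have "h * ((n - h) choose k) \<le> unordered_copies ?F ?H"
    by (rule unordered_copies_star_ge[OF q(1) an])
  also have "\<dots> \<le> extremal_copies k (\<lambda>i. if i = 0 then n else m * num_simplices i (std_simplex k)) ?H"
  proof (rule extremal_copies_ge)
    fix i assume i: "i \<le> k"
    show "num_simplices i ?F \<le> (if i = 0 then n else m * num_simplices i (std_simplex k))"
    proof (cases "i = 0")
      case True
      then show ?thesis
        using card_vertices_eq[OF abstract_complex_star[of "{1..n}" "{1..h}" q]] Union_star_complex[OF q(1), of "{1..n}" "{1..h}"]
        by simp
    next
      case False
      have "num_simplices i ?F \<le> m"
      proof (cases i q rule: linorder_cases)
        case less
        then show ?thesis using num_simplices_star_le[of i q n h] False n1 mn by simp
      next
        case equal
        then show ?thesis using card_star_top_le[of n h q] mn by (simp add: num_simplices_def)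
      next
        case greater
        then have "{s \<in> ?F. card s = i + 1} = {}" by (auto simp: star_complex_def)
        then show ?thesis unfolding num_simplices_def by (simp only: card.empty)
      qed
      also have "m * 1 \<le> m * num_simplices i (std_simplex k)"
        unfolding num_simplices_std_simplex using i by (intro mult_left_mono) (auto simp: Suc_le_eq)
      finally show ?thesis using False by simp
    qed
  qed (intro abstract_complex_star, simp)+
  finally have "real (h * ((n - h) choose k))
      \<le> real (extremal_copies k (\<lambda>i. if i = 0 then n else m * num_simplices i (std_simplex k)) ?H)"
    by (rule of_nat_mono)
  also have "\<dots> \<le> Psi k (p n) n ?H" using m sub ne by blast
  also have "\<dots> = real n ^ (k + 1) * real n powr - B" by (rule Psi_star[OF n1])
  also have "\<dots> = real n ^ k * real n powr (1 - B)"
    using n1 powr_add[of "real n" 1 "- B"] by simp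
  finally have up: "real h * real ((n - h) choose k) \<le> real n ^ k * real n powr (1 - B)" by simp
  have k: "real k > 0" using q by simp
  have "k \<le> n - h" using a2 n by linarith
  have "(real n / (2 * real k)) ^ k \<le> (real (n - h) / real k) ^ k"
  proof (rule power_mono)
    have "real n \<le> 2 * real (n - h)" using a2 an by simp
    then show "real n / (2 * real k) \<le> real (n - h) / real k" using k by (simp add: field_simps)
  qed simp
  also have "\<dots> \<le> real ((n - h) choose k)" by (rule binomial_ge_n_over_k_pow_k[OF \<open>k \<le> n - h\<close>])
  finally have bin: "(real n / (2 * real k)) ^ k \<le> real ((n - h) choose k)" .
  have y: "real n powr (1 - B) > 0" using n1 by simp
  \<comment> \<open>Half of \<open>C0\<close> is lost to rounding. In the rest, the power of
    \<open>2 * real k\<close> compensates the estimate of the binomial coefficient, and the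
    remaining factor 2 yields the contradiction.\<close>
  have "2 * (2 * real k) ^ k * real n powr (1 - B) \<le> C0 / 2 * real n powr (1 - B)"
    using C0 by (intro mult_right_mono) auto
  also note ge
  finally have "2 * (2 * real k) ^ k * real n powr (1 - B) \<le> real h" .
  from mult_mono[OF this bin] k
  have "2 * (2 * real k) ^ k * real n powr (1 - B) * (real n / (2 * real k)) ^ k \<le> real h * real ((n - h) choose k)"
    by simp
  also have "2 * (2 * real k) ^ k * real n powr (1 - B) * (real n / (2 * real k)) ^ k = 2 * (real n ^ k * real n powr (1 - B))"
    using k by (simp add: power_divide)
  finally have "2 * (real n ^ k * real n powr (1 - B)) \<le> real n ^ k * real n powr (1 - B)"
    using up by linarith
  moreover have "real n ^ k * real n powr (1 - B) > 0" using n1 y by (intro mult_pos_pos) auto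
  ultimately show False by linarith
qed

lemma M_star_bounds:
  "\<exists>C\<ge>1. \<forall>\<^sub>F n in sequentially. inverse C * real n powr e \<le> real (M_star k (p n) n (std_simplex k))
     \<and> real (M_star k (p n) n (std_simplex k)) \<le> C * real n powr e"
proof -
  obtain C1 where C1: "C1 \<ge> 1"
    "\<forall>\<^sub>F n in sequentially. admissible n \<noteq> {} \<and> inverse C1 * real n powr e \<le> real (M_star k (p n) n (std_simplex k))"
    using M_star_ge by blast
  define C0 where "C0 = 4 * (2 * real k) ^ k"
  have "1 \<le> (2 * real k) ^ k" using q by (intro one_le_power) simp
  then have "4 * 1 \<le> C0" unfolding C0_def by (intro mult_left_mono) simp_all
  then have C0: "C0 \<ge> 2" by simp
  define C where "C = max C1 (C0 + 1)"
  have "\<forall>\<^sub>F n in sequentially. inverse C * real n powr e \<le> real (M_star k (p n) n (std_simplex k))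
     \<and> real (M_star k (p n) n (std_simplex k)) \<le> C * real n powr e"
  proof (rule eventually_mono[OF eventually_conj[OF C1(2) eventually_conj[OF eventually_centres[OF C0]
      eventually_powr_ge[of "1 - B" 1]]]])
    show "1 - B > 0" using degree by linarith
    fix n
    let ?a = "nat \<lfloor>C0 * real n powr (1 - B)\<rfloor>"
    let ?M = "M_star k (p n) n (std_simplex k)"
    assume "(admissible n \<noteq> {} \<and> inverse C1 * real n powr e \<le> real ?M)
      \<and> (2 * k + 1 \<le> n \<and> 2 * real ?a \<le> real n \<and> C0 / 2 * real n powr (1 - B) \<le> real ?a) \<and> 1 \<le> real n powr (1 - B)"
    then have ne: "admissible n \<noteq> {}" and low: "inverse C1 * real n powr e \<le> real ?M"
      and n: "2 * k + 1 \<le> n" "2 * real ?a \<le> real n" "C0 / 2 * real n powr (1 - B) \<le> real ?a"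
      and y: "1 \<le> real n powr (1 - B)" by blast+
    have n1: "n \<ge> 1" using n(1) by simp
    have "inverse C \<le> inverse C1" using C1(1) by (intro le_imp_inverse_le) (auto simp: C_def)
    then have lower: "inverse C * real n powr e \<le> inverse C1 * real n powr e" by (rule mult_right_mono) simp
    have "?M \<in> admissible n" unfolding M_star_def by (rule Max_in[OF finite_admissible ne])
    then have "real ?M \<le> real ?a * real n ^ q + real n ^ q"
      by (rule admissible_le[OF _ n(1,2) _ n(3)]) (simp add: C0_def)
    also have "real ?a * real n ^ q + real n ^ q = (real ?a + 1) * real n ^ q" by (simp add: algebra_simps)
    also have "\<dots> \<le> ((C0 + 1) * real n powr (1 - B)) * real n ^ q"
    proof (rule mult_right_mono)
      have "real ?a \<le> C0 * real n powr (1 - B)" using C0 by (intro of_nat_floor) simp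
      then show "real ?a + 1 \<le> (C0 + 1) * real n powr (1 - B)"
        using y unfolding distrib_right by linarith
    qed simp
    also have "\<dots> = (C0 + 1) * real n powr e" by (simp only: powr_e_eq[OF n1] mult.assoc)
    also have "\<dots> \<le> C * real n powr e" by (intro mult_right_mono) (auto simp: C_def)
    finally have "real ?M \<le> C * real n powr e" .
    with lower show "inverse C * real n powr e \<le> real ?M \<and> real ?M \<le> C * real n powr e"
      using low by linarith
  qed
  moreover have "C \<ge> 1" using C1(1) by (simp add: C_def)
  ultimately show ?thesis by blast
qed

text \<open>The \<open>k choose q\<close> simplices of size \<open>q + 1\<close> through the vertex
  0 are mapped into the planted complex, so their weight, in total \<open>n powr - B\<close>, is not
  paid again. Any further shared simplices only help, as weights are at most 1.\<close>

lemma weight_Un_star_ge: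
  assumes n: "n \<ge> 1" and f: "f \<in> simplex_maps n k" "f 0 \<in> {1..h}"
  shows "(\<Prod>s\<in>star_complex {1..n} {1..h} q. simplex_weight (p n) s) * (W n * real n powr B)
    \<le> (\<Prod>s\<in>star_complex {1..n} {1..h} q \<union> image_complex k f. simplex_weight (p n) s)"
proof -
  let ?w = "simplex_weight (p n) :: nat set \<Rightarrow> real"
  let ?L = "star_complex {1..n} {1..h} q"
  let ?T = "{s. s \<subseteq> {0..k} \<and> 0 \<in> s \<and> card s = Suc q}"
  have finL: "finite ?L" using abstract_complex_star[of "{1..n}"] by (simp add: abstract_complex_def)
  have fin: "finite (image_complex k f)" using finite_std_simplex by (simp add: image_complex_def)
  have wnn: "0 \<le> ?w s" for s using p_bounds[OF n] by (simp add: simplex_weight_def)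
  have TS: "?T \<subseteq> std_simplex k" by (auto simp: std_simplex_def)
  have finT: "finite ?T" by (rule finite_subset[OF TS finite_std_simplex])
  have fn: "f ` {0..k} \<subseteq> {1..n}" using f(1) by (auto simp: simplex_maps_def PiE_iff)
  have inj: "inj_on ((`) f) ?T"
    by (rule inj_on_subset[OF inj_on_image_simplex_maps[OF f(1)] TS])
  have hit: "(`) f ` ?T \<subseteq> image_complex k f \<inter> ?L"
  proof (rule image_subsetI)
    fix s assume s: "s \<in> ?T"
    have "card (f ` s) = q + 1" using card_image_simplex_maps[OF f(1), of s] s by simp
    moreover have "f ` s \<subseteq> {1..n}" using s fn by blast
    moreover have "f 0 \<in> f ` s" using s by blast
    then have "f ` s \<inter> {1..h} \<noteq> {}" using f(2) by blast
    ultimately have "f ` s \<in> ?L" unfolding star_complex_def by auto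
    then show "f ` s \<in> image_complex k f \<inter> ?L"
      using s TS by (auto simp: image_complex_def)
  qed
  have "(\<Prod>s\<in>image_complex k f \<inter> ?L. ?w s)
      = (\<Prod>s\<in>(image_complex k f \<inter> ?L) - (`) f ` ?T. ?w s) * (\<Prod>s\<in>(`) f ` ?T. ?w s)"
    by (rule prod.subset_diff[OF hit]) (use fin in simp)
  also have "\<dots> \<le> 1 * (\<Prod>s\<in>(`) f ` ?T. ?w s)"
    using wnn simplex_weight_le_1[OF n] by (intro mult_right_mono prod_le_1 prod_nonneg conjI)
  also have "(\<Prod>s\<in>(`) f ` ?T. ?w s) = (\<Prod>s\<in>?T. real n powr - a q)"
    unfolding prod.reindex[OF inj] comp_def
  proof (rule prod.cong[OF refl])
    fix s assume s: "s \<in> ?T"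
    have "card (f ` s) = q + 1" using card_image_simplex_maps[OF f(1), of s] s by simp
    then show "?w (f ` s) = real n powr - a q" using simplex_weight_eq[OF n, of "f ` s"] q(2) by simp
  qed
  also have "\<dots> = (real n powr - a q) ^ card ?T" by simp
  also have "card ?T = k choose q" by (subst card_subsets_containing) auto
  also have "(real n powr - a q) ^ (k choose q) = real n powr - B"
    using n by (simp add: powr_realpow[symmetric] powr_powr mult.commute)
  finally have int: "(\<Prod>s\<in>image_complex k f \<inter> ?L. ?w s) \<le> real n powr - B" by simp
  have dnn: "0 \<le> (\<Prod>s\<in>image_complex k f - ?L. ?w s)" using wnn by (rule prod_nonneg)
  have "W n = (\<Prod>s\<in>image_complex k f. ?w s)" by (rule prod_weight_image_complex[OF f(1), symmetric])
  also have "\<dots> = (\<Prod>s\<in>image_complex k f \<inter> ?L. ?w s) * (\<Prod>s\<in>image_complex k f - ?L. ?w s)"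
    using fin by (rule prod.Int_Diff)
  also have "\<dots> \<le> real n powr - B * (\<Prod>s\<in>image_complex k f - ?L. ?w s)"
    using int dnn by (rule mult_right_mono)
  finally have "W n * real n powr B \<le> real n powr - B * (\<Prod>s\<in>image_complex k f - ?L. ?w s) * real n powr B"
    by (rule mult_right_mono) simp
  also have "\<dots> = (\<Prod>s\<in>image_complex k f - ?L. ?w s) * real n powr (- B + B)"
    unfolding powr_add by (simp only: mult_ac)
  also have "\<dots> = (\<Prod>s\<in>image_complex k f - ?L. ?w s)" using n by simp
  finally have "W n * real n powr B \<le> (\<Prod>s\<in>image_complex k f - ?L. ?w s)" .
  moreover have "0 \<le> (\<Prod>s\<in>?L. ?w s)" using wnn by (rule prod_nonneg)
  ultimately have "(\<Prod>s\<in>?L. ?w s) * (W n * real n powr B) \<le> (\<Prod>s\<in>?L. ?w s) * (\<Prod>s\<in>image_complex k f - ?L. ?w s)"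
    by (rule mult_left_mono)
  also have "\<dots> = (\<Prod>s\<in>?L \<union> image_complex k f. ?w s)"
    using prod.union_disjoint[of ?L "image_complex k f - ?L" ?w] fin finL by simp
  finally show ?thesis .
qed

text \<open>Only the maps sending 0 to a centre are kept. They are a fraction of at least
  \<open>h / n\<close> of all maps and each gains \<open>n powr B\<close>, whence the factor
  \<open>h * n powr (B - 1)\<close>.\<close>

lemma expectation_star_ge:
  assumes n: "n \<ge> 1" and h: "h \<le> n"
  shows "real h * real n powr (B - 1) * expected_ordered_copies n (p n) (std_simplex k)
      * (\<Prod>s\<in>star_complex {1..n} {1..h} q. simplex_weight (p n) s)
    \<le> measure_pmf.expectation (random_complex n (p n))
        (\<lambda>K. indicator {K. star_complex {1..n} {1..h} q \<subseteq> K} K * real (ordered_copies K (std_simplex k)))"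
proof -
  let ?w = "simplex_weight (p n) :: nat set \<Rightarrow> real"
  let ?L = "star_complex {1..n} {1..h} q"
  let ?S = "{f \<in> simplex_maps n k. f 0 \<in> {1..h}}"
  have wnn: "0 \<le> (\<Prod>s\<in>A. ?w s)" for A
    using p_bounds[OF n] by (intro prod_nonneg) (simp add: simplex_weight_def)
  have cL: "abstract_complex ?L" by (intro abstract_complex_star) simp
  have "real (card (simplex_maps n k)) * real h * real n powr (B - 1)
      \<le> real n * real (card ?S) * real n powr (B - 1)"
    using card_simplex_maps_starting[OF h n] by (rule mult_right_mono) simp
  also have "\<dots> = real (card ?S) * real n powr B"
    using n by (simp add: powr_diff)
  finally have cnt: "real (card (simplex_maps n k)) * real h * real n powr (B - 1) \<le> real (card ?S) * real n powr B" .
  have "real h * real n powr (B - 1) * expected_ordered_copies n (p n) (std_simplex k) * (\<Prod>s\<in>?L. ?w s)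
      = (real (card (simplex_maps n k)) * real h * real n powr (B - 1)) * (W n * (\<Prod>s\<in>?L. ?w s))"
    unfolding expected_ordered_copies_eq[OF p_bounds[OF n] n] by (simp only: mult_ac)
  also have "\<dots> \<le> (real (card ?S) * real n powr B) * (W n * (\<Prod>s\<in>?L. ?w s))"
    using wnn W_pos[OF n] by (intro mult_right_mono[OF cnt] mult_nonneg_nonneg) (simp_all add: less_imp_le)
  also have "\<dots> = (\<Sum>f\<in>?S. (\<Prod>s\<in>?L. ?w s) * (W n * real n powr B))"
    unfolding sum_constant by (simp only: mult_ac)
  also have "\<dots> \<le> (\<Sum>f\<in>?S. \<Prod>s\<in>?L \<union> image_complex k f. ?w s)"
    by (rule sum_mono) (use weight_Un_star_ge[OF n] in blast)
  also have "\<dots> \<le> (\<Sum>f\<in>simplex_maps n k. \<Prod>s\<in>?L \<union> image_complex k f. ?w s)"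
    by (rule sum_mono2[OF finite_simplex_maps]) (auto intro: wnn)
  also have "\<dots> = (\<Sum>f\<in>simplex_maps n k. measure_pmf.expectation (random_complex n (p n))
      (\<lambda>K. indicator {K. ?L \<union> image_complex k f \<subseteq> K} K * real (ordered_copies K (std_simplex k)) ^ 0))"
  proof (rule sum.cong[OF refl])
    fix f assume f: "f \<in> simplex_maps n k"
    have "?L \<union> image_complex k f \<subseteq> Pow {1..n}"
      using image_complex_subset[OF f] by (auto simp: star_complex_def)
    from expectation_indicator_superset[OF p_bounds[OF n] n abstract_complex_Un[OF cL abstract_complex_image_complex] this]
    show "(\<Prod>s\<in>?L \<union> image_complex k f. ?w s) = measure_pmf.expectation (random_complex n (p n))
      (\<lambda>K. indicator {K. ?L \<union> image_complex k f \<subseteq> K} K * real (ordered_copies K (std_simplex k)) ^ 0)"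
      unfolding power_0 mult_1_right by (rule sym)
  qed
  also have "\<dots> = measure_pmf.expectation (random_complex n (p n))
      (\<lambda>K. indicator {K. ?L \<subseteq> K} K * real (ordered_copies K (std_simplex k)) ^ Suc 0)"
    by (rule expectation_power_step[OF p_bounds[OF n] n, symmetric])
  finally show ?thesis unfolding power_Suc0_right .
qed

text \<open>
  Without conditioning: the number of copies is at most \<open>n ^ (k + 1)\<close>, so an expectation above
  twice the threshold already forces the tail event to have a probability of polynomial order.
\<close>

lemma upper_tail_ge_aux:
  assumes n: "n \<ge> 1" "k + 1 \<le> n" and h: "h \<le> n" and \<epsilon>: "\<epsilon> > 0"
    and ratio: "2 * (1 + \<epsilon>) \<le> real h * real n powr (B - 1)"
  shows "W n * (\<Prod>s\<in>star_complex {1..n} {1..h} q. simplex_weight (p n) s)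
    \<le> real n ^ (k + 1) * measure_pmf.prob (random_complex n (p n))
      {K. real (ordered_copies K (std_simplex k)) \<ge> (1 + \<epsilon>) * expected_ordered_copies n (p n) (std_simplex k)}"
proof -
  let ?N = "\<lambda>K. real (ordered_copies K (std_simplex k))"
  let ?mu = "expected_ordered_copies n (p n) (std_simplex k)"
  let ?M = "random_complex n (p n)"
  let ?L = "star_complex {1..n} {1..h} q"
  let ?t = "(1 + \<epsilon>) * ?mu"
  define w where "w = (\<Prod>s\<in>?L. simplex_weight (p n) s)"
  have w: "w \<ge> 0" unfolding w_def
    using p_bounds[OF n(1)] by (intro prod_nonneg) (simp add: simplex_weight_def)
  have mu: "?mu > 0" by (rule expected_pos[OF n])
  have t: "?t > 0" using mu \<epsilon> by simp
  have cL: "abstract_complex ?L" by (intro abstract_complex_star) simp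
  have LP: "?L \<subseteq> Pow {1..n}" by (auto simp: star_complex_def)
  define tw where "tw = ?t * w"
  have "2 * tw = 2 * (1 + \<epsilon>) * ?mu * w" by (simp add: tw_def)
  also have "\<dots> \<le> real h * real n powr (B - 1) * ?mu * w"
    using ratio mu w by (intro mult_right_mono) auto
  also have "\<dots> \<le> measure_pmf.expectation ?M (\<lambda>K. indicator {K. ?L \<subseteq> K} K * ?N K)"
    unfolding w_def by (rule expectation_star_ge[OF n(1) h])
  \<comment> \<open>Pointwise split: outside the tail event the count is below \<open>?t\<close>,
    inside it is at most \<open>n ^ (k + 1)\<close>.\<close>
  also have "\<dots> \<le> measure_pmf.expectation ?M
      (\<lambda>K. ?t * indicator {K. ?L \<subseteq> K} K + real n ^ (k + 1) * indicator {K. ?N K \<ge> ?t} K)"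
  proof (rule integral_mono_AE[OF integrable_random_complex integrable_random_complex], rule AE_pmfI)
    fix K assume "K \<in> set_pmf ?M"
    from ordered_copies_le[OF this, of k]
    show "indicator {K. ?L \<subseteq> K} K * ?N K \<le> ?t * indicator {K. ?L \<subseteq> K} K + real n ^ (k + 1) * indicator {K. ?N K \<ge> ?t} K"
      using t by (simp add: indicator_def)
  qed
  also have "\<dots> = measure_pmf.expectation ?M (\<lambda>K. ?t * indicator {K. ?L \<subseteq> K} K)
      + measure_pmf.expectation ?M (\<lambda>K. real n ^ (k + 1) * indicator {K. ?N K \<ge> ?t} K)"
    by (rule Bochner_Integration.integral_add[OF integrable_random_complex integrable_random_complex])
  also have "\<dots> = ?t * measure_pmf.prob ?M {K. ?L \<subseteq> K} + real n ^ (k + 1) * measure_pmf.prob ?M {K. ?N K \<ge> ?t}"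
    by simp
  also have "measure_pmf.prob ?M {K. ?L \<subseteq> K} = w"
    unfolding w_def by (rule prob_random_complex_superset[OF p_bounds[OF n(1)] cL LP n(1)])
  finally have "2 * tw \<le> tw + real n ^ (k + 1) * measure_pmf.prob ?M {K. ?N K \<ge> ?t}"
    unfolding tw_def .
  then have main: "?t * w \<le> real n ^ (k + 1) * measure_pmf.prob ?M {K. ?N K \<ge> ?t}"
    unfolding tw_def[symmetric] by linarith
  \<comment> \<open>Since there is at least one injective map, the threshold is at least
    \<open>W n\<close>, an explicit power of \<open>n\<close>.\<close>
  have "1 \<le> real (card (simplex_maps n k))"
  proof -
    have "(\<Prod>i=0..<k+1. n - i) > 0" using n(2) by (intro prod_pos) auto
    then show ?thesis unfolding card_simplex_maps by linarith
  qed
  then have "1 * W n \<le> ?mu"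
    unfolding expected_ordered_copies_eq[OF p_bounds[OF n(1)] n(1)]
    using W_pos[OF n(1)] by (intro mult_right_mono) (auto simp: less_imp_le)
  also have "?mu \<le> ?t" using \<epsilon> mu by simp
  finally have "W n * w \<le> ?t * w" using w by (intro mult_right_mono) auto
  with main show ?thesis unfolding w_def by linarith
qed

lemma upper_tail_ge:
  assumes \<epsilon>: "\<epsilon> > 0"
  shows "\<exists>C>0. \<forall>\<^sub>F n in sequentially.
    exp (- (C * real n powr e * ln (real n)))
    \<le> measure_pmf.prob (random_complex n (p n))
      {K. real (ordered_copies K (std_simplex k)) \<ge> (1 + \<epsilon>) * expected_ordered_copies n (p n) (std_simplex k)}"
proof -
  \<comment> \<open>Rounding the number of centres halves this constant, and
    \<open>2 * (1 + \<epsilon>)\<close> is the required ratio.\<close>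
  define C0 where "C0 = 4 * (1 + \<epsilon>)"
  have C0: "C0 \<ge> 2" using \<epsilon> by (simp add: C0_def)
  define S where "S = (\<Sum>s\<in>{s\<in>std_simplex k. q < card s}. a (card s - 1))"
  have S: "S \<ge> 0" unfolding S_def
  proof (rule sum_nonneg)
    fix s assume "s \<in> {s\<in>std_simplex k. q < card s}"
    then have "1 \<le> card s - 1" "card s - 1 \<le> k" using q(1) card_std_simplex_le[of s] by auto
    then show "0 \<le> a (card s - 1)" by (rule a_nonneg)
  qed
  \<comment> \<open>The summands pay for the weight of one copy, for the planted
    \<open>q\<close>-simplices and for the division by \<open>n ^ (k + 1)\<close>. Only the second
    cost grows like \<open>n powr e\<close>; the others are constants, absorbed by
    \<open>1 \<le> n powr e\<close>. The logarithm appears because each cost is an exponent of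
    \<open>n\<close>.\<close>
  define C where "C = S + C0 * a q + real (k + 1)"
  have "C > 0" unfolding C_def using S C0 a_q by (intro add_nonneg_pos add_nonneg_nonneg mult_nonneg_nonneg) auto
  moreover have "\<forall>\<^sub>F n in sequentially.
    exp (- (C * real n powr e * ln (real n)))
    \<le> measure_pmf.prob (random_complex n (p n))
      {K. real (ordered_copies K (std_simplex k)) \<ge> (1 + \<epsilon>) * expected_ordered_copies n (p n) (std_simplex k)}"
  proof (rule eventually_mono[OF eventually_conj[OF eventually_centres[OF C0] eventually_powr_ge[OF e_pos, of 1]]])
    fix n
    let ?h = "nat \<lfloor>C0 * real n powr (1 - B)\<rfloor>"
    let ?P = "measure_pmf.prob (random_complex n (p n))
      {K. real (ordered_copies K (std_simplex k)) \<ge> (1 + \<epsilon>) * expected_ordered_copies n (p n) (std_simplex k)}"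
    let ?L = "star_complex {1..n} {1..?h} q"
    assume "(2 * k + 1 \<le> n \<and> 2 * real ?h \<le> real n \<and> C0 / 2 * real n powr (1 - B) \<le> real ?h) \<and> 1 \<le> real n powr e"
    then have n: "2 * k + 1 \<le> n" "2 * real ?h \<le> real n" "C0 / 2 * real n powr (1 - B) \<le> real ?h"
      and ne: "1 \<le> real n powr e" by blast+
    have n1: "n \<ge> 1" "k + 1 \<le> n" "?h \<le> n" using n(1,2) by linarith+
    have npos: "real n > 0" using n1(1) by simp
    have "2 * (1 + \<epsilon>) = C0 / 2 * (real n powr (1 - B) * real n powr (B - 1))"
      using npos unfolding powr_add[symmetric] by (simp add: C0_def)
    also have "\<dots> \<le> real ?h * real n powr (B - 1)"
      unfolding mult.assoc[symmetric] using n(3) by (rule mult_right_mono) simp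
    finally have ratio: "2 * (1 + \<epsilon>) \<le> real ?h * real n powr (B - 1)" .
    define T where "T = real (card {s \<in> ?L. card s = q + 1}) * a q"
    have wL: "(\<Prod>s\<in>?L. simplex_weight (p n) s) = real n powr - T"
      unfolding T_def by (rule prod_weight_star[OF n1(1) finite_atLeastAtMost])
    have Weq: "W n = real n powr - S"
      unfolding S_def by (rule prod_weight_eq[OF n1(1) finite_std_simplex card_std_simplex_le])
    have "T \<le> C0 * a q * real n powr e"
    proof -
      have "real (card {s \<in> ?L. card s = q + 1}) \<le> real (?h * n ^ q)"
        by (rule of_nat_mono[OF card_star_top_le])
      also have "\<dots> = real ?h * real n ^ q" by simp
      also have "\<dots> \<le> (C0 * real n powr (1 - B)) * real n ^ q"
        using C0 by (intro mult_right_mono of_nat_floor) auto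
      also have "\<dots> = C0 * real n powr e" by (simp only: powr_e_eq[OF n1(1)] mult.assoc)
      finally have "T \<le> C0 * real n powr e * a q"
        unfolding T_def using a_q by (intro mult_right_mono) auto
      then show ?thesis by (simp only: mult_ac)
    qed
    moreover have "S + real (k + 1) \<le> (S + real (k + 1)) * real n powr e"
      using mult_left_mono[OF ne, of "S + real (k + 1)"] S by simp
    ultimately have exponent: "S + T + real (k + 1) \<le> C * real n powr e"
      unfolding C_def distrib_right by linarith
    have "real n powr - S * real n powr - T \<le> real n ^ (k + 1) * ?P"
      using upper_tail_ge_aux[OF n1 \<epsilon> ratio] unfolding wL Weq .
    then have "real n powr - S * real n powr - T * real n powr - real (k + 1)
        \<le> real n ^ (k + 1) * ?P * real n powr - real (k + 1)"
      by (rule mult_right_mono) simp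
    also have "\<dots> = ?P * (real n powr real (k + 1) * real n powr - real (k + 1))"
      unfolding powr_realpow[OF npos, symmetric] by (simp only: mult_ac)
    also have "\<dots> = ?P" using npos unfolding powr_add[symmetric] by simp
    also have "real n powr - S * real n powr - T * real n powr - real (k + 1) = real n powr - (S + T + real (k + 1))"
      unfolding powr_add[symmetric] by simp
    finally have "real n powr - (S + T + real (k + 1)) \<le> ?P" .
    moreover have "exp (- (C * real n powr e * ln (real n))) = real n powr - (C * real n powr e)"
      using npos by (simp add: powr_def)
    moreover have "real n powr - (C * real n powr e) \<le> real n powr - (S + T + real (k + 1))"
      using exponent n1(1) by (intro powr_mono) auto
    ultimately show "exp (- (C * real n powr e * ln (real n))) \<le> ?P" by linarith
  qed
  ultimately show ?thesis by blast
qed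

end

section \<open>From extended to real exponents, and the conclusion\<close>

lemma clique_exponentsI:
  fixes \<alpha> :: "nat \<Rightarrow> ennreal" and k q :: nat
  assumes k: "1 \<le> k"
    and sum: "(\<Sum>i=1..k. of_nat (k choose i) * \<alpha> i) < 1"
    and ex: "\<exists>i\<ge>1. \<alpha> i > 0"
    and q: "q = (LEAST i. 1 \<le> i \<and> \<alpha> i > 0)" "q \<le> k"
    and top: "q < k \<longrightarrow> (\<forall>k0\<in>{q+1..k}.
           ennreal ((real k - real q) / (real k + 1) * real ((k + 1) choose (q + 1))) * \<alpha> q
             + (\<Sum>j=q+1..k0. of_nat ((k + 1) choose (j + 1)) * \<alpha> j)
           < ennreal (real k0 - real q))"
  shows "clique_exponents k q (\<lambda>i. enn2real (\<alpha> i)) (power_prob \<alpha>)"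
proof -
  define a where "a i = enn2real (\<alpha> i)" for i
  have qprop: "1 \<le> q \<and> \<alpha> q > 0"
    using LeastI_ex[OF ex] unfolding q(1)[symmetric] .
  have term_le: "of_nat (k choose i) * \<alpha> i < 1" if "1 \<le> i" "i \<le> k" for i
  proof -
    have "of_nat (k choose i) * \<alpha> i \<le> (\<Sum>i=1..k. of_nat (k choose i) * \<alpha> i)"
      by (rule member_le_sum) (use that in auto)
    also note sum
    finally show ?thesis .
  qed
  \<comment> \<open>Each \<open>\<alpha> i\<close> with \<open>1 \<le> i \<le> k\<close> occurs in
    the first sum with a coefficient of at least 1, so it is finite and the hypotheses can be read
    in the reals. An infinite value is possible only beyond \<open>k\<close>.\<close>
  have lt1: "\<alpha> i < 1" if i: "1 \<le> i" "i \<le> k" for i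
  proof (rule le_less_trans[OF _ term_le[OF i]])
    have "1 \<le> k choose i" using i(2) by (simp add: Suc_le_eq)
    from of_nat_mono[OF this] have "(1::ennreal) \<le> of_nat (k choose i)" by simp
    then have "1 * \<alpha> i \<le> of_nat (k choose i) * \<alpha> i" by (rule mult_right_mono) simp
    then show "\<alpha> i \<le> of_nat (k choose i) * \<alpha> i" by simp
  qed
  have fin: "\<alpha> i < top" if "1 \<le> i" "i \<le> k" for i
    by (rule less_trans[OF lt1[OF that]]) simp
  have \<alpha>: "\<alpha> i = ennreal (a i)" if "1 \<le> i" "i \<le> k" for i
    unfolding a_def by (rule ennreal_enn2real[OF fin[OF that], symmetric])
  have ann: "0 \<le> a i" for i by (simp add: a_def)
  have aq: "0 < a q"
    using qprop fin[of q] q(2) by (simp add: a_def enn2real_positive_iff)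
  have degree: "real (k choose q) * a q < 1"
  proof -
    have "ennreal (real (k choose q) * a q) = of_nat (k choose q) * \<alpha> q"
      using \<alpha>[of q] qprop q(2)
      by (simp only: ennreal_mult[OF of_nat_0_le_iff ann] ennreal_of_nat_eq_real_of_nat)
    also have "\<dots> < ennreal 1" using term_le[of q] qprop q(2) by simp
    finally show ?thesis using ann by (subst (asm) ennreal_less_iff) auto
  qed
  have absorb: "real (q + 1) * real ((k + 1) choose (q + 1)) = real (k + 1) * real (k choose q)"
  proof -
    have "(q + 1) * ((k + 1) choose (q + 1)) = (k + 1) * (k choose q)"
      using Suc_times_binomial_eq[of k q] by simp
    then show ?thesis unfolding of_nat_mult[symmetric] by (rule arg_cong)
  qed
  have top': "(\<Sum>j=q..k0. real ((k + 1) choose (j + 1)) * a j) \<le> real k0 - real q + real (k choose q) * a q"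
    if k0: "q < k0" "k0 \<le> k" for k0
  proof -
    let ?c = "(real k - real q) / (real k + 1) * real ((k + 1) choose (q + 1))"
    let ?s = "\<Sum>j=q+1..k0. real ((k + 1) choose (j + 1)) * a j"
    have cnn: "0 \<le> ?c" using q(2) by simp
    have snn: "0 \<le> ?s" using ann by (intro sum_nonneg mult_nonneg_nonneg) auto
    have "(\<Sum>j=q+1..k0. of_nat ((k + 1) choose (j + 1)) * \<alpha> j) = (\<Sum>j=q+1..k0. ennreal (real ((k + 1) choose (j + 1)) * a j))"
    proof (rule sum.cong[OF refl])
      fix j assume "j \<in> {q+1..k0}"
      then have "\<alpha> j = ennreal (a j)" using k0(2) by (intro \<alpha>) auto
      then show "of_nat ((k + 1) choose (j + 1)) * \<alpha> j = ennreal (real ((k + 1) choose (j + 1)) * a j)"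
        by (simp only: ennreal_mult[OF of_nat_0_le_iff ann] ennreal_of_nat_eq_real_of_nat)
    qed
    also have "\<dots> = ennreal ?s"
      using ann by (intro sum_ennreal) auto
    finally have sums: "(\<Sum>j=q+1..k0. of_nat ((k + 1) choose (j + 1)) * \<alpha> j) = ennreal ?s" .
    have "ennreal ?c * \<alpha> q = ennreal (?c * a q)"
      using \<alpha>[of q] qprop q(2) by (simp only: ennreal_mult[OF cnn ann])
    moreover have "ennreal ?c * \<alpha> q + (\<Sum>j=q+1..k0. of_nat ((k + 1) choose (j + 1)) * \<alpha> j) < ennreal (real k0 - real q)"
    proof -
      have "q < k" "k0 \<in> {q+1..k}" using k0 by auto
      then show ?thesis using top by blast
    qed
    ultimately have "ennreal (?c * a q) + ennreal ?s < ennreal (real k0 - real q)"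
      unfolding sums by simp
    then have "ennreal (?c * a q + ?s) < ennreal (real k0 - real q)"
      by (simp only: ennreal_plus[OF mult_nonneg_nonneg[OF cnn ann] snn])
    then have lt: "?c * a q + ?s < real k0 - real q"
      by (simp only: ennreal_less_iff[OF add_nonneg_nonneg[OF mult_nonneg_nonneg[OF cnn ann] snn]])
    have "x - (real k - real q) / (real k + 1) * x = real (q + 1) * x / (real k + 1)" for x :: real
      by (simp add: divide_simps) (simp add: algebra_simps)
    then have "real ((k + 1) choose (q + 1)) - ?c = real (q + 1) * real ((k + 1) choose (q + 1)) / (real k + 1)" .
    also have "\<dots> = real (k choose q)" unfolding absorb by (simp add: field_simps)
    finally have "real ((k + 1) choose (q + 1)) = ?c + real (k choose q)"
      by (simp only: diff_eq_eq add.commute)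
    from arg_cong[OF this, of "\<lambda>x. x * a q"]
    have "real ((k + 1) choose (q + 1)) * a q = ?c * a q + real (k choose q) * a q"
      unfolding distrib_right .
    moreover have "(\<Sum>j=q..k0. real ((k + 1) choose (j + 1)) * a j) = real ((k + 1) choose (q + 1)) * a q + ?s"
      using k0(1) by (subst sum.atLeast_Suc_atMost) auto
    ultimately show ?thesis using lt by linarith
  qed
  show ?thesis
  proof (unfold_locales, fold a_def)
    show "1 \<le> q" "q \<le> k" using qprop q(2) by auto
    show "0 \<le> a i" for i by (rule ann)
    show "a i = 0" if "1 \<le> i" "i < q" for i
    proof -
      have "\<not> (1 \<le> i \<and> \<alpha> i > 0)" using that(2) unfolding q(1) by (rule not_less_Least)
      then have "\<alpha> i = 0" using that(1) by simp
      then show ?thesis by (simp add: a_def)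
    qed
    show "0 < a q" by (rule aq)
    show "real (k choose q) * a q < 1" by (rule degree)
    show "(\<Sum>j=q..k0. real ((k + 1) choose (j + 1)) * a j) \<le> real k0 - real q + real (k choose q) * a q"
      if "q < k0" "k0 \<le> k" for k0 using top'[OF that] .
    show "power_prob \<alpha> n i = real n powr - a i" if "1 \<le> n" "1 \<le> i" "i \<le> k" for n i
      using fin[OF that(2,3)] by (auto simp: power_prob_def a_def)
    show "0 \<le> power_prob \<alpha> n i \<and> power_prob \<alpha> n i \<le> 1" if "1 \<le> n" for n i
    proof -
      have "real n powr - a i \<le> real n powr 0"
        using that ann[of i] by (intro powr_mono) auto
      then show ?thesis using that by (simp add: power_prob_def a_def)
    qed
  qed
qed

theorem proposition4p1:
  fixes \<alpha> :: "nat \<Rightarrow> ennreal" and k q :: nat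
  assumes "1 \<le> k"
    and "(\<Sum>i=1..k. of_nat (k choose i) * \<alpha> i) < 1"
    and "\<exists>i\<ge>1. \<alpha> i > 0"
    and "q = (LEAST i. 1 \<le> i \<and> \<alpha> i > 0)"
    and "q \<le> k"
    and "q < k \<longrightarrow> (\<forall>k0\<in>{q+1..k}.
           ennreal ((real k - real q) / (real k + 1) * real ((k + 1) choose (q + 1))) * \<alpha> q
             + (\<Sum>j=q+1..k0. of_nat ((k + 1) choose (j + 1)) * \<alpha> j)
           < ennreal (real k0 - real q))"
  shows "(\<exists>C\<ge>1. \<forall>\<^sub>F n in sequentially.
            inverse C * real n powr (real q + 1 - real (k choose q) * enn2real (\<alpha> q))
              \<le> real (M_star k (power_prob \<alpha> n) n (std_simplex k))
          \<and> real (M_star k (power_prob \<alpha> n) n (std_simplex k))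
              \<le> C * real n powr (real q + 1 - real (k choose q) * enn2real (\<alpha> q)))
    \<and> (\<forall>\<epsilon>>0. \<exists>C'>0. \<exists>C''>0. \<forall>\<^sub>F n in sequentially.
            exp (- (C' * real n powr (real q + 1 - real (k choose q) * enn2real (\<alpha> q)) * ln (real n)))
              \<le> measure_pmf.prob (random_complex n (power_prob \<alpha> n))
                  {K. real (ordered_copies K (std_simplex k))
                        \<ge> (1 + \<epsilon>) * expected_ordered_copies n (power_prob \<alpha> n) (std_simplex k)}
          \<and> measure_pmf.prob (random_complex n (power_prob \<alpha> n))
                  {K. real (ordered_copies K (std_simplex k))
                        \<ge> (1 + \<epsilon>) * expected_ordered_copies n (power_prob \<alpha> n) (std_simplex k)}
              \<le> exp (- (C'' * real n powr (real q + 1 - real (k choose q) * enn2real (\<alpha> q)))))"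
proof -
  interpret clique_exponents k q "\<lambda>i. enn2real (\<alpha> i)" "power_prob \<alpha>"
    by (rule clique_exponentsI[OF assms])
  show ?thesis
  proof (intro conjI allI impI)
    fix \<epsilon> :: real assume \<epsilon>: "\<epsilon> > 0"
    let ?P = "\<lambda>n. measure_pmf.prob (random_complex n (power_prob \<alpha> n))
      {K. real (ordered_copies K (std_simplex k))
        \<ge> (1 + \<epsilon>) * expected_ordered_copies n (power_prob \<alpha> n) (std_simplex k)}"
    obtain C' where C': "C' > 0" "\<forall>\<^sub>F n in sequentially. exp (- (C' * real n powr e * ln (real n))) \<le> ?P n"
      using upper_tail_ge[OF \<epsilon>] by blast
    obtain C'' where C'': "C'' > 0" "\<forall>\<^sub>F n in sequentially. ?P n \<le> exp (- (C'' * real n powr e))"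
      using upper_tail_le[OF \<epsilon>] by blast
    show "\<exists>C'>0. \<exists>C''>0. \<forall>\<^sub>F n in sequentially.
        exp (- (C' * real n powr e * ln (real n))) \<le> ?P n \<and> ?P n \<le> exp (- (C'' * real n powr e))"
      using C'(1) C''(1) eventually_conj[OF C'(2) C''(2)] by blast
  qed (rule M_star_bounds)
qed

end
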